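(* Let $\Gamma$, $D$, $q$, $H$, the vector space $\Lambda$ and the maps $A^{(1)},A^{(2)},A^{(3)},A^{*(1)},A^{*(2)},A^{*(3)}$ be as described in the context. The vector space $\Lambda$ becomes a $U'_q(\mathfrak{so}_6)$-module on which \[ B_1=\frac{A^{*(1)}}{H(q^2-q^{-2})},\qquad B_3=\frac{A^{*(2)}}{H(q^2-q^{-2})},\qquad B_5=\frac{A^{*(3)}}{H(q^2-q^{-2})}, \] \[ B_2=\frac{A^{(3)}}{H(q^{-2}-q^{2})},\qquad B_4=\frac{A^{(1)}}{H(q^{-2}-q^{2})},\qquad B_6=\frac{A^{(2)}}{H(q^{-2}-q^{2})}. \]
   Context: GRAPH SETTING. $\Gamma=(X,\mathcal R)$ is a finite undirected connected graph without loops or multiple edges, with vertex set $X$, $|X|\ge 2$, path-length distance $\partial$ and diameter $D=\max\{\partial(x,y)\mid x,y\in X\}$. Write $\Gamma_i(x)=\{y\in X\mid\partial(x,y)=i\}$ and $\Gamma(x)=\Gamma_1(x)$. $\Gamma$ is distance-regular: for $0\le h,i,j\le D$ and $\partial(x,y)=h$, the number $p^h_{i,j}=|\Gamma_i(x)\cap\Gamma_j(y)|$ depends only on $h,i,j$. Put $c_i=p^i_{1,i-1}$, $a_i=p^i_{1,i}$, $b_i=p^i_{1,i+1}$ ($c_0=0$, $b_D=0$), $k_i=p^0_{i,i}$. $V$ is the complex vector space with basis $X$. For $0\le i\le D$, $A_i\in\mathrm{End}(V)$ sends $x\mapsto\sum_{\xi\in\Gamma_i(x)}\xi$; $A=A_1$.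 The $A_i$ form a basis of a commutative algebra $M\subseteq\mathrm{End}(V)$ generated by $A$. The primitive idempotents $E_0,\dots,E_D$ are the basis of $M$ with $E_iE_j=\delta_{i,j}E_i$, $\sum_iE_i=I$, $E_0=|X|^{-1}\sum_iA_i$. The Krein parameters $q^h_{i,j}$ are given by $E_i\circ E_j=|X|^{-1}\sum_hq^h_{i,j}E_h$, where $\circ$ is the entrywise product of matrices with respect to the basis $X$. The ordering $E_0,\dots,E_D$ is $Q$-polynomial if for all $0\le h,i,j\le D$: $q^h_{i,j}=0$ when one of $h,i,j$ exceeds the sum of the other two, and $q^h_{i,j}\ne0$ when one of them equals the sum of the other two; $\Gamma$ is $Q$-polynomial if such an ordering exists. $\theta_i$ is defined by $AE_i=\theta_iE_i$, and $\theta^*_i$ by $E_1=|X|^{-1}\sum_{i=0}^D\theta^*_iA_i$. $\Gamma$ is bipartite if $a_i=0$ for all $i$; a bipartite $\Gamma$ is called 2-homogeneous if $k_D=1$ (antipodal 2-cover) and $\Gamma$ is $Q$-polynomial. ASSUMPTION. $D\ge3$, $\Gamma$ is 2-homogeneous bipartite, not a hypercube and not a cycle, and $\{E_i\}_{i=0}^D$ is a fixed $Q$-polynomial ordering. Then there is a nonzero $q\in\mathbb C$, not a root of unity, which we fix, such that for $0\le i\le D$: $\theta_i=\theta^*_i=H\sqrt{-1}\,(q^{D-2i}-q^{2i-D})$, $c_i=H\sqrt{-1}\,\frac{q^{2i}-q^{-2i}}{q^{D-2i}+q^{2i-D}}$, $b_i=H\sqrt{-1}\,\frac{q^{2D-2i}-q^{2i-2D}}{q^{D-2i}+q^{2i-D}}$,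 where $H=\sqrt{-1}\,\frac{q^{D-2}+q^{2-D}}{q^{-2}-q^{2}}$. THE SPACE $\Lambda$ AND THE SIX MAPS. $V^{\otimes3}=V\otimes V\otimes V$. $\mathcal P_D$ is the set of $(r,s,t,u)\in\mathbb N^4$ ($0\in\mathbb N$) with $r+s+t+u=D$. Every $x,y,z\in X$ have a unique profile $(r,s,t,u)\in\mathcal P_D$, determined by $\partial(x,y)=s+t$, $\partial(y,z)=t+u$, $\partial(z,x)=u+s$. For $(r,s,t,u)\in\mathcal P_D$, $B(r,s,t,u)=\sum x\otimes y\otimes z$ over all triples $x,y,z\in X$ of profile $(r,s,t,u)$. $\Lambda$ is the subspace of $V^{\otimes3}$ with basis $\{B(r,s,t,u)\}_{(r,s,t,u)\in\mathcal P_D}$. The maps in $\mathrm{End}(V^{\otimes3})$ are, for $x,y,z\in X$: $A^{(1)}(x\otimes y\otimes z)=\sum_{\xi\in\Gamma(x)}\xi\otimes y\otimes z$, $A^{(2)}(x\otimes y\otimes z)=\sum_{\xi\in\Gamma(y)}x\otimes\xi\otimes z$, $A^{(3)}(x\otimes y\otimes z)=\sum_{\xi\in\Gamma(z)}x\otimes y\otimes\xi$, $A^{*(1)}(x\otimes y\otimes z)=\theta^*_{\partial(y,z)}x\otimes y\otimes z$, $A^{*(2)}(x\otimes y\otimes z)=\theta^*_{\partial(z,x)}x\otimes y\otimes z$, $A^{*(3)}(x\otimes y\otimes z)=\theta^*_{\partial(x,y)}x\otimes y\otimes z$. All six leave $\Lambda$ invariant, and in the claim they denote the restrictions to $\Lambda$.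 THE ALGEBRA $U'_q(\mathfrak{so}_6)$. It is the associative unital complex algebra with generators $B_1,\dots,B_5$ and relations: $B_i^2B_j-(q^2+q^{-2})B_iB_jB_i+B_jB_i^2=-B_j$ if $|i-j|=1$; $B_iB_j=B_jB_i$ if $|i-j|\ge2$. With $[R,S]_q=qRS-q^{-1}SR$, the element $B_6$ is defined by $B_6=-[B_1,[B_2,[B_3,[B_4,B_5]_q]_q]_q]_q$. *)

theory Defs
  imports
    "HOL-Analysis.Analysis"
    "HOL-Library.Poly_Mapping"
    "HOL-Algebra.QuotRing"
begin

section \<open>Distance-regular graphs\<close>

text \<open>A graph is given by its adjacency relation on a finite type, whose elements are the vertices.\<close>

definition simple_graph :: "('a::finite \<Rightarrow> 'a \<Rightarrow> bool) \<Rightarrow> bool" where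
  "simple_graph adj \<longleftrightarrow> symp adj \<and> irreflp adj"

definition graph_connected :: "('a::finite \<Rightarrow> 'a \<Rightarrow> bool) \<Rightarrow> bool" where
  "graph_connected adj \<longleftrightarrow> (\<forall>x y. \<exists>n. (adj ^^ n) x y)"

text \<open>\<open>(adj ^^ n) x y\<close> says that there is a walk of length \<open>n\<close> from \<open>x\<close> to \<open>y\<close>.\<close>

definition gdist :: "('a::finite \<Rightarrow> 'a \<Rightarrow> bool) \<Rightarrow> 'a \<Rightarrow> 'a \<Rightarrow> nat" where
  "gdist adj x y = (LEAST n. (adj ^^ n) x y)"

definition diam :: "('a::finite \<Rightarrow> 'a \<Rightarrow> bool) \<Rightarrow> nat" where
  "diam adj = Max {gdist adj x y | x y. True}"

definition gsphere :: "('a::finite \<Rightarrow> 'a \<Rightarrow> bool) \<Rightarrow> nat \<Rightarrow> 'a \<Rightarrow> 'a set" where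
  "gsphere adj i x = {y. gdist adj x y = i}"

definition distance_regular :: "('a::finite \<Rightarrow> 'a \<Rightarrow> bool) \<Rightarrow> bool" where
  "distance_regular adj \<longleftrightarrow>
     (\<forall>h\<le>diam adj. \<forall>i\<le>diam adj. \<forall>j\<le>diam adj. \<exists>p. \<forall>x y. gdist adj x y = h \<longrightarrow>
        card (gsphere adj i x \<inter> gsphere adj j y) = p)"

definition inter_num :: "('a::finite \<Rightarrow> 'a \<Rightarrow> bool) \<Rightarrow> nat \<Rightarrow> nat \<Rightarrow> nat \<Rightarrow> nat" where
  "inter_num adj h i j =
     (THE p. \<forall>x y. gdist adj x y = h \<longrightarrow> card (gsphere adj i x \<inter> gsphere adj j y) = p)"

definition c_num :: "('a::finite \<Rightarrow> 'a \<Rightarrow> bool) \<Rightarrow> nat \<Rightarrow> nat" where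
  "c_num adj i = (if i = 0 then 0 else inter_num adj i 1 (i - 1))"

definition a_num :: "('a::finite \<Rightarrow> 'a \<Rightarrow> bool) \<Rightarrow> nat \<Rightarrow> nat" where
  "a_num adj i = inter_num adj i 1 i"

definition b_num :: "('a::finite \<Rightarrow> 'a \<Rightarrow> bool) \<Rightarrow> nat \<Rightarrow> nat" where
  "b_num adj i = (if i = diam adj then 0 else inter_num adj i 1 (i + 1))"

definition k_num :: "('a::finite \<Rightarrow> 'a \<Rightarrow> bool) \<Rightarrow> nat \<Rightarrow> nat" where
  "k_num adj i = inter_num adj 0 i i"

definition is_hypercube :: "('a::finite \<Rightarrow> 'a \<Rightarrow> bool) \<Rightarrow> bool" where
  "is_hypercube adj \<longleftrightarrow> (\<exists>(n::nat) f. bij_betw f UNIV (Pow {..<n}) \<and>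
     (\<forall>x y. adj x y \<longleftrightarrow> card ((f x - f y) \<union> (f y - f x)) = 1))"

definition is_cycle :: "('a::finite \<Rightarrow> 'a \<Rightarrow> bool) \<Rightarrow> bool" where
  "is_cycle adj \<longleftrightarrow> (\<exists>(n::nat) f. n \<ge> 3 \<and> bij_betw f UNIV {..<n} \<and>
     (\<forall>x y. adj x y \<longleftrightarrow> f y = (f x + 1) mod n \<or> f x = (f y + 1) mod n))"


section \<open>The Bose-Mesner algebra and \<open>Q\<close>-polynomial orderings\<close>

text \<open>Endomorphisms of the complex vector space with basis the vertex set are represented by their
  matrices with respect to that basis; products of endomorphisms are matrix products \<open>**\<close>.\<close>

definition smat :: "complex \<Rightarrow> complex^'n^'m \<Rightarrow> complex^'n^'m" where
  "smat c M = (\<chi> i j. c * M $ i $ j)"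

interpretation smat: vector_space "smat :: complex \<Rightarrow> complex^'n^'m \<Rightarrow> complex^'n^'m"
  by unfold_locales (simp_all add: smat_def vec_eq_iff algebra_simps)

definition hadamard :: "complex^'n^'m \<Rightarrow> complex^'n^'m \<Rightarrow> complex^'n^'m" where
  "hadamard M N = (\<chi> i j. M $ i $ j * N $ i $ j)"

definition dist_mat :: "('a::finite \<Rightarrow> 'a \<Rightarrow> bool) \<Rightarrow> nat \<Rightarrow> complex^'a^'a" where
  "dist_mat adj i = (\<chi> y x. if y \<in> gsphere adj i x then 1 else 0)"

definition bose_mesner :: "('a::finite \<Rightarrow> 'a \<Rightarrow> bool) \<Rightarrow> (complex^'a^'a) set" where
  "bose_mesner adj = smat.span (dist_mat adj ` {..diam adj})"

text \<open>An ordering of the primitive idempotents is a sequence of which only the entries with index at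
  most the diameter matter.\<close>

definition primitive_idempotents ::
  "('a::finite \<Rightarrow> 'a \<Rightarrow> bool) \<Rightarrow> (nat \<Rightarrow> complex^'a^'a) \<Rightarrow> bool" where
  "primitive_idempotents adj E \<longleftrightarrow>
     inj_on E {..diam adj} \<and>
     smat.independent (E ` {..diam adj}) \<and>
     smat.span (E ` {..diam adj}) = bose_mesner adj \<and>
     (\<forall>i\<le>diam adj. \<forall>j\<le>diam adj. E i ** E j = (if i = j then E i else 0)) \<and>
     (\<Sum>i\<le>diam adj. E i) = mat 1 \<and>
     E 0 = smat (1 / of_nat CARD('a)) (\<Sum>i\<le>diam adj. dist_mat adj i)"

text \<open>\<open>krein adj E i j h\<close> is the Krein parameter with lower indices \<open>i, j\<close> and upper index \<open>h\<close>.\<close>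

definition krein ::
  "('a::finite \<Rightarrow> 'a \<Rightarrow> bool) \<Rightarrow> (nat \<Rightarrow> complex^'a^'a) \<Rightarrow> nat \<Rightarrow> nat \<Rightarrow> nat \<Rightarrow> complex" where
  "krein adj E i j = (THE \<kappa>. (\<forall>h>diam adj. \<kappa> h = 0) \<and>
     hadamard (E i) (E j) = smat (1 / of_nat CARD('a)) (\<Sum>h\<le>diam adj. smat (\<kappa> h) (E h)))"

definition Q_polynomial_ordering ::
  "('a::finite \<Rightarrow> 'a \<Rightarrow> bool) \<Rightarrow> (nat \<Rightarrow> complex^'a^'a) \<Rightarrow> bool" where
  "Q_polynomial_ordering adj E \<longleftrightarrow>
     primitive_idempotents adj E \<and>
     (\<forall>h\<le>diam adj. \<forall>i\<le>diam adj. \<forall>j\<le>diam adj.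
        ((h > i + j \<or> i > h + j \<or> j > h + i) \<longrightarrow> krein adj E i j h = 0) \<and>
        ((h = i + j \<or> i = h + j \<or> j = h + i) \<longrightarrow> krein adj E i j h \<noteq> 0))"

definition eigval ::
  "('a::finite \<Rightarrow> 'a \<Rightarrow> bool) \<Rightarrow> (nat \<Rightarrow> complex^'a^'a) \<Rightarrow> nat \<Rightarrow> complex" where
  "eigval adj E i = (THE t. dist_mat adj 1 ** E i = smat t (E i))"

definition dual_eigval ::
  "('a::finite \<Rightarrow> 'a \<Rightarrow> bool) \<Rightarrow> (nat \<Rightarrow> complex^'a^'a) \<Rightarrow> nat \<Rightarrow> complex" where
  "dual_eigval adj E = (THE t. (\<forall>i>diam adj. t i = 0) \<and>
     E 1 = smat (1 / of_nat CARD('a)) (\<Sum>i\<le>diam adj. smat (t i) (dist_mat adj i)))"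

definition bipartite_drg :: "('a::finite \<Rightarrow> 'a \<Rightarrow> bool) \<Rightarrow> bool" where
  "bipartite_drg adj \<longleftrightarrow> distance_regular adj \<and> (\<forall>i\<le>diam adj. a_num adj i = 0)"

definition two_homogeneous_bipartite :: "('a::finite \<Rightarrow> 'a \<Rightarrow> bool) \<Rightarrow> bool" where
  "two_homogeneous_bipartite adj \<longleftrightarrow>
     bipartite_drg adj \<and> k_num adj (diam adj) = 1 \<and> (\<exists>E. Q_polynomial_ordering adj E)"


section \<open>The space \<open>\<Lambda>\<close> and the six maps\<close>

text \<open>The threefold tensor power of the space with basis the vertex set is the space with basis the
  set of triples of vertices.\<close>

definition tens :: "'a::finite \<Rightarrow> 'a \<Rightarrow> 'a \<Rightarrow> complex^('a \<times> 'a \<times> 'a)" where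
  "tens x y z = axis (x, y, z) 1"

definition lin_ext :: "('a::finite \<Rightarrow> 'a \<Rightarrow> 'a \<Rightarrow> complex^('a \<times> 'a \<times> 'a)) \<Rightarrow>
    complex^('a \<times> 'a \<times> 'a) \<Rightarrow> complex^('a \<times> 'a \<times> 'a)" where
  "lin_ext f v = (\<Sum>x\<in>UNIV. \<Sum>y\<in>UNIV. \<Sum>z\<in>UNIV. v $ (x, y, z) *s f x y z)"

definition has_profile :: "('a::finite \<Rightarrow> 'a \<Rightarrow> bool) \<Rightarrow> 'a \<Rightarrow> 'a \<Rightarrow> 'a \<Rightarrow>
    nat \<times> nat \<times> nat \<times> nat \<Rightarrow> bool" where
  "has_profile adj x y z = (\<lambda>(r, s, t, u). r + s + t + u = diam adj \<and>
     gdist adj x y = s + t \<and> gdist adj y z = t + u \<and> gdist adj z x = u + s)"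

definition profile_vec :: "('a::finite \<Rightarrow> 'a \<Rightarrow> bool) \<Rightarrow> nat \<times> nat \<times> nat \<times> nat \<Rightarrow>
    complex^('a \<times> 'a \<times> 'a)" where
  "profile_vec adj p = (\<Sum>(x, y, z)\<in>{(x, y, z). has_profile adj x y z p}. tens x y z)"

definition profiles :: "nat \<Rightarrow> (nat \<times> nat \<times> nat \<times> nat) set" where
  "profiles D = {(r, s, t, u). r + s + t + u = D}"

definition Lambda :: "('a::finite \<Rightarrow> 'a \<Rightarrow> bool) \<Rightarrow> (complex^('a \<times> 'a \<times> 'a)) set" where
  "Lambda adj = vec.span (profile_vec adj ` profiles (diam adj))"

definition A_1 where
  "A_1 adj = lin_ext (\<lambda>x y z. \<Sum>\<xi>\<in>gsphere adj 1 x. tens \<xi> y z)"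

definition A_2 where
  "A_2 adj = lin_ext (\<lambda>x y z. \<Sum>\<xi>\<in>gsphere adj 1 y. tens x \<xi> z)"

definition A_3 where
  "A_3 adj = lin_ext (\<lambda>x y z. \<Sum>\<xi>\<in>gsphere adj 1 z. tens x y \<xi>)"

definition Astar_1 where
  "Astar_1 adj E = lin_ext (\<lambda>x y z. dual_eigval adj E (gdist adj y z) *s tens x y z)"

definition Astar_2 where
  "Astar_2 adj E = lin_ext (\<lambda>x y z. dual_eigval adj E (gdist adj z x) *s tens x y z)"

definition Astar_3 where
  "Astar_3 adj E = lin_ext (\<lambda>x y z. dual_eigval adj E (gdist adj x y) *s tens x y z)"


section \<open>The algebra \<open>U'\<^sub>q(so\<^sub>6)\<close>\<close>

text \<open>The free monoid. With its operation written additively, the convolution product of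
  \<^theory>\<open>HOL-Library.Poly_Mapping\<close> makes \<open>'g word \<Rightarrow>\<^sub>0 complex\<close> the free
  associative unital complex algebra on the alphabet \<open>'g\<close>.\<close>

datatype 'g word = Word (letters: "'g list")

instantiation word :: (type) monoid_add
begin
definition zero_word :: "'g word" where "zero_word = Word []"
definition plus_word :: "'g word \<Rightarrow> 'g word \<Rightarrow> 'g word" where
  "plus_word v w = Word (letters v @ letters w)"
instance by standard (simp_all add: zero_word_def plus_word_def)
end

type_synonym 'g free_alg = "'g word \<Rightarrow>\<^sub>0 complex"

definition scalar :: "complex \<Rightarrow> 'g free_alg" where
  "scalar c = Poly_Mapping.single 0 c"

definition gen :: "'g \<Rightarrow> 'g free_alg" where
  "gen g = Poly_Mapping.single (Word [g]) 1"

text \<open>The free algebra on the generators with indices in \<open>G\<close>.\<close>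

definition free_algebra :: "'g set \<Rightarrow> 'g free_alg ring" where
  "free_algebra G = \<lparr>carrier = {f. \<forall>w\<in>Poly_Mapping.keys f. set (letters w) \<subseteq> G},
     mult = (*), one = 1, zero = 0, add = (+)\<rparr>"

definition so6_relators :: "complex \<Rightarrow> nat free_alg set" where
  "so6_relators q =
     {gen i * gen i * gen j - scalar (q powi 2 + q powi (-2)) * (gen i * gen j * gen i)
        + gen j * gen i * gen i - (- gen j)
      | i j. i \<in> {1..5} \<and> j \<in> {1..5} \<and> \<bar>int i - int j\<bar> = 1}
     \<union> {gen i * gen j - gen j * gen i
      | i j. i \<in> {1..5} \<and> j \<in> {1..5} \<and> \<bar>int i - int j\<bar> \<ge> 2}"

definition so6_ideal :: "complex \<Rightarrow> nat free_alg set" where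
  "so6_ideal q = genideal (free_algebra {1..5}) (so6_relators q)"

definition U_so6 :: "complex \<Rightarrow> nat free_alg set ring" where
  "U_so6 q = free_algebra {1..5} Quot so6_ideal q"

definition U_class :: "complex \<Rightarrow> nat free_alg \<Rightarrow> nat free_alg set" where
  "U_class q f = so6_ideal q +>\<^bsub>free_algebra {1..5}\<^esub> f"

definition U_scalar :: "complex \<Rightarrow> complex \<Rightarrow> nat free_alg set" where
  "U_scalar q c = U_class q (scalar c)"

definition U_gen :: "complex \<Rightarrow> nat \<Rightarrow> nat free_alg set" where
  "U_gen q i = U_class q (gen i)"

definition U_qcomm ::
  "complex \<Rightarrow> nat free_alg set \<Rightarrow> nat free_alg set \<Rightarrow> nat free_alg set" where
  "U_qcomm q R S =
     (U_scalar q q \<otimes>\<^bsub>U_so6 q\<^esub> (R \<otimes>\<^bsub>U_so6 q\<^esub> S))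
       \<ominus>\<^bsub>U_so6 q\<^esub> (U_scalar q (q powi (-1)) \<otimes>\<^bsub>U_so6 q\<^esub> (S \<otimes>\<^bsub>U_so6 q\<^esub> R))"

definition U_B6 :: "complex \<Rightarrow> nat free_alg set" where
  "U_B6 q = \<ominus>\<^bsub>U_so6 q\<^esub>
     U_qcomm q (U_gen q 1) (U_qcomm q (U_gen q 2) (U_qcomm q (U_gen q 3)
       (U_qcomm q (U_gen q 4) (U_gen q 5))))"

text \<open>Left modules over a complex algebra that is not assumed commutative. The algebra is a ring
  \<open>U\<close> with the map \<open>\<iota>\<close> sending a complex number to the corresponding multiple of the unit; the
  module is a complex subspace \<open>L\<close>, and its given complex structure is the one induced by \<open>\<iota>\<close>.\<close>

locale complex_algebra_module = ring U
  for U :: "('u, 'm) ring_scheme" (structure) +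
  fixes \<iota> :: "complex \<Rightarrow> 'u" and L :: "(complex^'n) set"
    and act :: "'u \<Rightarrow> complex^'n \<Rightarrow> complex^'n"
  assumes subspace: "vec.subspace L"
    and act_closed: "\<lbrakk>a \<in> carrier U; v \<in> L\<rbrakk> \<Longrightarrow> act a v \<in> L"
    and act_add_right: "\<lbrakk>a \<in> carrier U; v \<in> L; w \<in> L\<rbrakk> \<Longrightarrow> act a (v + w) = act a v + act a w"
    and act_add_left: "\<lbrakk>a \<in> carrier U; b \<in> carrier U; v \<in> L\<rbrakk> \<Longrightarrow> act (a \<oplus> b) v = act a v + act b v"
    and act_mult: "\<lbrakk>a \<in> carrier U; b \<in> carrier U; v \<in> L\<rbrakk> \<Longrightarrow> act (a \<otimes> b) v = act a (act b v)"
    and act_one: "v \<in> L \<Longrightarrow> act \<one> v = v"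
    and act_scalar: "v \<in> L \<Longrightarrow> act (\<iota> c) v = c *s v"

end

theory Submission
  imports Defs
begin

text \<open>Write \<open>[n] = q^n - q^-n\<close>, \<open>{n} = q^n + q^-n\<close> and \<open>K = {D-2}/[2]\<close>, which equals \<open>H \<i>\<close>. In this
  notation \<open>\<theta>\<^sub>i = \<theta>\<^sup>*\<^sub>i = K [D-2i]\<close>.

  The graph enters the proof through one fact. Let \<open>x, y, z\<close> be vertices, and put
  \<open>I = D - 2\<partial>(x,y)\<close>, \<open>J = D - 2\<partial>(x,z)\<close>, \<open>L = D - 2\<partial>(y,z)\<close>. For signs \<open>\<epsilon>, \<delta>\<close>, the number of neighbours of
  \<open>x\<close> at distance \<open>\<partial>(x,y) + \<epsilon>\<close> from \<open>y\<close> and \<open>\<partial>(x,z) + \<delta>\<close> from \<open>z\<close> is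
  \<open>K ([D + \<epsilon>I + \<delta>J] + \<epsilon>\<delta>[L]) / ({I}{J})\<close> (lemma \<open>neighbour_count_eq\<close>). The intersection numbers give three
  linear equations for the four counts. The fourth comes from \<open>balanced_neighbours\<close>: if \<open>S\<close> is the set
  of the neighbours of \<open>x\<close> that are closer to \<open>z\<close>, then the sum of the \<open>E\<^sub>1 w\<close> over \<open>w \<in> S\<close> is a
  combination \<open>\<alpha> E\<^sub>1 x + \<beta> E\<^sub>1 z\<close>. Indeed, let \<open>u\<close> be the sum of \<open>S\<close> minus \<open>\<alpha>x + \<beta>z\<close>. As the graph is
  bipartite, two distinct elements of \<open>S\<close> are at distance 2, so the entries of \<open>E\<^sub>1 u\<close> at \<open>x\<close>, at \<open>z\<close>
  and on \<open>S\<close> are known; for the right \<open>\<alpha>, \<beta>\<close> they all vanish. But \<open>E\<^sub>1\<close> is an orthogonal projection,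
  so \<open>\<parallel>E\<^sub>1 u\<parallel>\<^sup>2 = \<langle>u, E\<^sub>1 u\<rangle> = 0\<close>.

  The defining relations of the algebra even hold on the whole tensor cube. Two generators
  commute if both are multiplications, if both are moves of different vertices, or if one moves a
  vertex and the other depends on the distance between the remaining two. A cubic
  relation involves one moving vertex and its distance to one other vertex. It follows from the
  recurrence \<open>\<theta>\<^sub>i\<^sub>-\<^sub>1 + \<theta>\<^sub>i\<^sub>+\<^sub>1 = (q\<^sup>2 + q^-2) \<theta>\<^sub>i\<close> when the multiplication occurs twice
  (\<open>theta_multiplier_relation\<close>), and from \<open>balanced_neighbours\<close> for vertices at distance 2 when the move
  occurs twice (\<open>theta_neighbour_relation\<close>).

  The formula for \<open>B\<^sub>6\<close> needs \<open>\<Lambda>\<close>. Every triple of vertices has a profile, since the graph is bipartite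
  and every vertex has a unique antipode; hence \<open>\<Lambda>\<close> consists of the vectors whose entry at \<open>(x,y,z)\<close>
  is a function of the three distances (\<open>Lambda_iff\<close>). On such functions the six maps are multiplications
  and difference operators with explicit coefficients, and the formula becomes an identity
  between difference operators on the integer grid (\<open>quadruple_bracket\<close>). In the iterated
  commutator of a move of \<open>x\<close>, a move of \<open>z\<close> and three multiplications, the terms that change \<open>\<partial>(z,x)\<close> by
  \<open>\<plusminus>2\<close> cancel, and the remaining ones change \<open>\<partial>(x,y)\<close> and \<open>\<partial>(y,z)\<close> by \<open>\<plusminus>1\<close>, as a move of \<open>y\<close> does.\<close>

section \<open>Sums and differences of inverse powers of \<open>q\<close>\<close>

locale generic_q =
  fixes q :: complex
  assumes q_nonzero: "q \<noteq> 0" and q_not_root: "n > 0 \<Longrightarrow> q ^ n \<noteq> 1"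
begin

text \<open>Below, \<open>qs n\<close> is written \<open>[n]\<close> and \<open>qc n\<close> is written \<open>{n}\<close>.\<close>

definition qs :: "int \<Rightarrow> complex" where "qs n = q powi n - q powi (- n)"
definition qc :: "int \<Rightarrow> complex" where "qc n = q powi n + q powi (- n)"

lemma powi_eq_1_iff: "q powi n = 1 \<longleftrightarrow> n = 0"
proof (cases "n \<ge> 0")
  case True
  then obtain m where "n = int m" using nonneg_int_cases by blast
  then show ?thesis using q_not_root[of m] by (cases "m = 0") auto
next
  case False
  then obtain m where "n = - int m" "m > 0" by (metis neg_int_cases not_le)
  then show ?thesis using q_not_root[of m] by (auto simp: power_int_minus)
qed

lemma qs_eq_0_iff: "qs n = 0 \<longleftrightarrow> n = 0"
proof -
  have "q powi n * qs n = q powi (2 * n) - 1"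
    using q_nonzero by (simp add: qs_def right_diff_distrib flip: power_int_add)
  then show ?thesis
    using powi_eq_1_iff[of "2 * n"] q_nonzero by (auto simp: qs_def)
qed

lemma qc_nonzero: "qc n \<noteq> 0"
proof
  assume 0: "qc n = 0"
  have "qs (2 * n) = qs n * qc n"
    using q_nonzero by (simp add: qs_def qc_def algebra_simps flip: power_int_add)
  with 0 have "n = 0" by (simp add: qs_eq_0_iff)
  with 0 show False by (simp add: qc_def)
qed

lemma qs_uminus: "qs (- n) = - qs n" and qc_uminus: "qc (- n) = qc n"
  and qs_zero: "qs 0 = 0"
  by (simp_all add: qs_def qc_def)

text \<open>Product-to-sum formulas. They reduce polynomial identities between the numbers \<open>[n]\<close> and \<open>{n}\<close> to
  linear ones.\<close>

lemma qs_mult_qc: "qs m * qc n = qs (m + n) + qs (m - n)"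
  and qs_mult_qs: "qs m * qs n = qc (m + n) - qc (m - n)"
  and qc_mult_qc: "qc m * qc n = qc (m + n) + qc (m - n)"
  using q_nonzero
  by (simp_all add: qs_def qc_def power_int_add power_int_diff power_int_minus field_simps)

end

section \<open>Identities for pairs of moves\<close>

text \<open>Replacing the powers \<open>q^I\<close>, \<open>q^J\<close>, \<open>q^L\<close>, \<open>q^D\<close> by independent variables turns the identities needed
  for \<open>B\<^sub>6\<close> into rational identities: \<open>[n]\<close> and \<open>{n}\<close> are the values of \<open>lsub\<close> and \<open>ladd\<close> at \<open>q^n\<close>.\<close>

definition lsub :: "complex \<Rightarrow> complex" where "lsub x = x - 1 / x"
definition ladd :: "complex \<Rightarrow> complex" where "ladd x = x + 1 / x"

text \<open>The numerator of the product of two neighbour counts, for a move of \<open>z\<close> by signs \<open>(\<eta>, -\<delta>)\<close> followed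
  by a move of \<open>x\<close> by signs \<open>(\<epsilon>, \<delta>)\<close>. Here \<open>A, B, C, w\<close> are \<open>q^(\<epsilon>I)\<close>, \<open>q^(\<delta>J)\<close>, \<open>q^(\<eta>L)\<close>, \<open>q^D\<close>, and
  \<open>\<tau> = \<epsilon>\<delta>\<eta>\<close>. The opposite order of the moves corresponds to \<open>C, A, 1/B, -\<tau>\<close> in place of \<open>A, C, B, \<tau>\<close>.\<close>

definition path_num :: "complex \<Rightarrow> complex \<Rightarrow> complex \<Rightarrow> complex \<Rightarrow> complex \<Rightarrow> complex \<Rightarrow> complex" where
  "path_num w q \<tau> A C B =
     (lsub (w * C / B) - \<tau> * lsub A) * (lsub (w * A * B * q^2) + \<tau> * lsub (C / q^2))"

definition path_defect :: "complex \<Rightarrow> complex \<Rightarrow> complex \<Rightarrow> complex \<Rightarrow> complex \<Rightarrow> complex" where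
  "path_defect w \<tau> A C B = (C / A - A / C) * lsub B + \<tau> * (w * (C^2 - A^2) + (1 / C^2 - 1 / A^2) / w)"

text \<open>In the sum over all paths the two numerators on the left occur over the common denominator
  \<open>ladd (B q\<^sup>2)\<close>, with weights that add up to a multiple of it. So this factorisation clears
  that denominator.\<close>

lemma path_num_swap:
  assumes "A \<noteq> 0" "B \<noteq> 0" "C \<noteq> 0" "w \<noteq> 0" "q \<noteq> 0" "\<tau>^2 = 1"
  shows "path_num w q \<tau> A C B - path_num w q \<tau> C A B = ladd (B * q^2) * path_defect w \<tau> A C B"
proof -
  have "\<tau> = 1 \<or> \<tau> = -1" using assms(6) by (simp add: power2_eq_1_iff)
  then show ?thesis
    using assms(1-5)
    by (elim disjE) (simp_all add: path_num_def path_defect_def lsub_def ladd_def field_simps power2_eq_square)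
qed

text \<open>What is left of the sum over all paths once the denominators \<open>ladd (B q\<^sup>2)\<close> and \<open>ladd (q\<^sup>2 / B)\<close>
  have been cleared.\<close>

lemma path_num_flip:
  assumes "A \<noteq> 0" "B \<noteq> 0" "C \<noteq> 0" "w \<noteq> 0" "q \<noteq> 0" "\<tau>^2 = 1"
  shows "path_num w q \<tau> C A B - path_num w q (-\<tau>) C A (1 / B) + q^2 * ladd B * path_defect w \<tau> A C B
    = - \<tau> * A / C * lsub (q^2) * ladd B * (lsub (w * A * C) + \<tau> * lsub B)"
proof -
  have "\<tau> = 1 \<or> \<tau> = -1" using assms(6) by (simp add: power2_eq_1_iff)
  then show ?thesis
    using assms(1-5)
    by (elim disjE) (simp_all add: path_num_def path_defect_def lsub_def ladd_def field_simps power2_eq_square)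
qed

text \<open>When a move of \<open>x\<close> and a move of \<open>z\<close> change \<open>\<partial>(z,x)\<close> in the same direction, the result is reached by
  a single pair of moves, and its weight is the same for both orders.\<close>

lemma commuting_identity:
  assumes "A \<noteq> 0" "B \<noteq> 0" "C \<noteq> 0" "w \<noteq> 0" "q \<noteq> 0" "\<sigma>^2 = 1"
  shows "(lsub (w * C * B) + \<sigma> * lsub A) * (lsub (w * A * B / q^2) + \<sigma> * lsub (C / q^2))
       = (lsub (w * A * B) + \<sigma> * lsub C) * (lsub (w * C * B / q^2) + \<sigma> * lsub (A / q^2))"
proof -
  have "\<sigma> = 1 \<or> \<sigma> = -1" using assms(6) by (simp add: power2_eq_1_iff)
  then show ?thesis
    using assms(1-5)
    by (elim disjE) (simp_all add: lsub_def field_simps power2_eq_square)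
qed

text \<open>The sum over \<open>\<delta> = \<plusminus>1\<close> of the weights of the two pairs of moves that leave \<open>\<partial>(z,x)\<close> unchanged, in both
  orders, up to common factors.\<close>

lemma two_path_identity:
  assumes "A \<noteq> 0" "B \<noteq> 0" "C \<noteq> 0" "w \<noteq> 0" "q \<noteq> 0" "\<tau>^2 = 1"
    and "ladd (B * q^2) \<noteq> 0" "ladd (q^2 / B) \<noteq> 0"
  shows "B * (q^3 * (path_num w q \<tau> A C B / ladd (B * q^2))
              - path_num w q (- \<tau>) C A (1 / B) / ladd (q^2 / B) / q)
       - 1 / B * (q^3 * (path_num w q (- \<tau>) A C (1 / B) / ladd (q^2 / B))
              - path_num w q \<tau> C A B / ladd (B * q^2) / q)
     = - \<tau> * q * (A / C) * lsub (q^2) * ladd B * (lsub (w * A * C) + \<tau> * lsub B)"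
proof -
  define F G L M where "F = path_num w q \<tau> C A B" and "G = path_num w q (- \<tau>) C A (1 / B)"
    and "L = ladd (B * q^2)" and "M = ladd (q^2 / B)"
  define P where "P = path_defect w \<tau> A C B"
  have 1: "path_num w q \<tau> A C B = F + L * P"
    using path_num_swap[of A B C w q \<tau>] assms by (simp add: F_def L_def P_def algebra_simps)
  have "path_defect w (- \<tau>) A C (1 / B) = - P"
    using assms(2) by (simp add: path_defect_def P_def lsub_def algebra_simps add_divide_distrib diff_divide_distrib)
  then have 2: "path_num w q (- \<tau>) A C (1 / B) = G - M * P"
    using path_num_swap[of A "1 / B" C w q "- \<tau>"] assms by (simp add: G_def M_def algebra_simps)
  have L: "L = B * q^2 + 1 / (B * q^2)" and M: "M = q^2 / B + B / q^2"
    by (simp_all add: L_def M_def ladd_def)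
  have nz: "L \<noteq> 0" "M \<noteq> 0" using assms by (simp_all add: L_def M_def)
  have "B * (q^3 * ((F + L * P) / L) - G / M / q) - 1 / B * (q^3 * ((G - M * P) / M) - F / L / q)
     = q * (B * q^2 + 1 / (B * q^2)) * F / L - q * (q^2 / B + B / q^2) * G / M
       + q^3 * (B + 1 / B) * P"
    using nz assms(2,5) by (simp add: field_simps power2_eq_square power3_eq_cube)
  also have "\<dots> = q * (F - G + q^2 * ladd B * P)"
    unfolding L[symmetric] M[symmetric] using nz
    by (simp add: ladd_def algebra_simps power2_eq_square power3_eq_cube)
  also have "\<dots> = q * (- \<tau> * A / C * lsub (q^2) * ladd B * (lsub (w * A * C) + \<tau> * lsub B))"
    using path_num_flip[of A B C w q \<tau>] assms by (simp add: F_def G_def P_def)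
  finally show ?thesis unfolding 1 2 F_def[symmetric] G_def[symmetric] L_def[symmetric] M_def[symmetric]
    by (simp add: algebra_simps)
qed

section \<open>Difference operators satisfying the relation that defines \<open>B\<^sub>6\<close>\<close>

lemma sum_signs: "(\<Sum>\<epsilon>\<in>{1, -1}. g \<epsilon>) = g 1 + g (-1)" for g :: "int \<Rightarrow> complex"
  by simp

type_synonym grid_fun = "int \<Rightarrow> int \<Rightarrow> int \<Rightarrow> complex"

context generic_q begin

text \<open>For \<open>d = D\<close>, \<open>I = D - 2\<partial>(x,y)\<close>, \<open>J = D - 2\<partial>(x,z)\<close> and \<open>L = D - 2\<partial>(y,z)\<close> this is the number of
  neighbours \<open>w\<close> of \<open>x\<close> with \<open>\<partial>(w,y) = \<partial>(x,y) + \<epsilon>\<close> and \<open>\<partial>(w,z) = \<partial>(x,z) + \<delta>\<close>, divided by \<open>K\<close>.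
  Replacing \<open>x\<close> by \<open>w\<close> changes \<open>I\<close> to \<open>I - 2\<epsilon>\<close> and \<open>J\<close> to \<open>J - 2\<delta>\<close>.\<close>

definition move_coeff :: "int \<Rightarrow> int \<Rightarrow> int \<Rightarrow> int \<Rightarrow> int \<Rightarrow> int \<Rightarrow> complex" where
  "move_coeff d \<epsilon> \<delta> I J L = (qs (d + \<epsilon> * I + \<delta> * J) + of_int (\<epsilon> * \<delta>) * qs L) / (qc I * qc J)"

lemma qs_lsub: "qs n = lsub (q powi n)" and qc_ladd: "qc n = ladd (q powi n)"
  by (simp_all add: qs_def qc_def lsub_def ladd_def power_int_minus field_simps)

lemma qs_sign: "s \<in> {1, -1} \<Longrightarrow> qs (s * n) = of_int s * qs n"
  by (auto simp: qs_uminus)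

text \<open>In a \<open>q\<close>-commutator of a move with the multiplication by \<open>[I]\<close>, one of the two exponentials cancels,
  and a monomial remains. This is the case where the move stands on the left.\<close>

lemma bracket_after:
  assumes "\<epsilon> \<in> {1, -1}"
  shows "q * qs (I - 2 * \<epsilon>) - qs I / q = - of_int \<epsilon> * q * qs 2 * q powi (- \<epsilon> * I)"
  using assms q_nonzero
  by (auto simp: qs_def power_int_add power_int_diff power_int_minus field_simps power2_eq_square)

text \<open>The companion for a multiplication that stands on the left of the move.\<close>

lemma bracket_before:
  assumes "\<epsilon> \<in> {1, -1}"
  shows "q * qs I - qs (I - 2 * \<epsilon>) / q = of_int \<epsilon> / q * qs 2 * q powi (\<epsilon> * I)"
  using assms q_nonzero
  by (auto simp: qs_def power_int_add power_int_diff power_int_minus field_simps power2_eq_square)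

lemma move_coeff_commute:
  assumes "\<epsilon> \<in> {1, -1}" "\<delta> \<in> {1, -1}" "\<eta> \<in> {1, -1}"
  shows "move_coeff d \<eta> \<delta> L J I * move_coeff d \<epsilon> \<delta> I (J - 2 * \<delta>) (L - 2 * \<eta>)
       = move_coeff d \<epsilon> \<delta> I J L * move_coeff d \<eta> \<delta> L (J - 2 * \<delta>) (I - 2 * \<epsilon>)"
proof -
  define A B C w \<sigma> where "A = q powi (\<epsilon> * I)" and "B = q powi (\<delta> * J)" and "C = q powi (\<eta> * L)"
    and "w = q powi d" and "\<sigma> = (of_int (\<epsilon> * \<delta> * \<eta>) :: complex)"
  have nz: "A \<noteq> 0" "B \<noteq> 0" "C \<noteq> 0" "w \<noteq> 0" "\<sigma>^2 = 1"
    using assms q_nonzero by (auto simp: A_def B_def C_def w_def \<sigma>_def)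
  have sq: "\<epsilon> * \<epsilon> = 1" "\<delta> * \<delta> = 1" "\<eta> * \<eta> = 1" using assms by auto
  have I: "of_int (\<eta> * \<delta>) * qs I = \<sigma> * lsub A"
    and L: "of_int (\<epsilon> * \<delta>) * qs L = \<sigma> * lsub C"
    unfolding A_def C_def qs_lsub[symmetric] qs_sign[OF assms(1)] qs_sign[OF assms(3)] \<sigma>_def
    using assms by auto
  have shifted: "lsub (A / q^2) = of_int \<epsilon> * qs (I - 2 * \<epsilon>)"
    "lsub (C / q^2) = of_int \<eta> * qs (L - 2 * \<eta>)"
  proof -
    have "lsub (A / q^2) = qs (\<epsilon> * I - 2)" "lsub (C / q^2) = qs (\<eta> * L - 2)"
      using q_nonzero by (simp_all add: A_def C_def qs_lsub power_int_diff)
    then show "lsub (A / q^2) = of_int \<epsilon> * qs (I - 2 * \<epsilon>)"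
      "lsub (C / q^2) = of_int \<eta> * qs (L - 2 * \<eta>)"
      using assms qs_uminus[of "I + 2"] qs_uminus[of "L + 2"] by auto
  qed
  have I': "of_int (\<eta> * \<delta>) * qs (I - 2 * \<epsilon>) = \<sigma> * lsub (A / q^2)"
    and L': "of_int (\<epsilon> * \<delta>) * qs (L - 2 * \<eta>) = \<sigma> * lsub (C / q^2)"
    unfolding shifted \<sigma>_def using assms by auto
  have arg: "qs (d + \<eta> * L + \<delta> * J) = lsub (w * C * B)" "qs (d + \<epsilon> * I + \<delta> * J) = lsub (w * A * B)"
    using q_nonzero by (simp_all add: qs_lsub power_int_add A_def B_def C_def w_def)
  have "d + \<epsilon> * I + \<delta> * (J - 2 * \<delta>) = d + \<epsilon> * I + \<delta> * J - 2"
    "d + \<eta> * L + \<delta> * (J - 2 * \<delta>) = d + \<eta> * L + \<delta> * J - 2"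
    using sq by (simp_all add: algebra_simps)
  then have arg': "qs (d + \<epsilon> * I + \<delta> * (J - 2 * \<delta>)) = lsub (w * A * B / q^2)"
     "qs (d + \<eta> * L + \<delta> * (J - 2 * \<delta>)) = lsub (w * C * B / q^2)"
    using q_nonzero by (simp_all add: qs_lsub power_int_add power_int_diff A_def B_def C_def w_def)
  show ?thesis
    unfolding move_coeff_def I L I' L' arg arg'
    using commuting_identity[OF nz(1-4) q_nonzero nz(5)] by (simp add: mult.commute)
qed

text \<open>The coefficient of the move \<open>(\<epsilon>, \<delta>)\<close> of \<open>x\<close> after commutators with the multiplications by \<open>[I]\<close> and \<open>[J]\<close>.\<close>

definition bracket_coeff :: "int \<Rightarrow> int \<Rightarrow> int \<Rightarrow> int \<Rightarrow> int \<Rightarrow> int \<Rightarrow> complex" where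
  "bracket_coeff d \<epsilon> \<delta> I J L
     = - of_int (\<epsilon> * \<delta>) * qs 2 ^ 2 * q powi (\<delta> * J - \<epsilon> * I) * move_coeff d \<epsilon> \<delta> I J L"

text \<open>The contribution of a move \<open>(\<epsilon>, \<delta>)\<close> of \<open>x\<close> and a move \<open>(\<eta>, \<zeta>)\<close> of \<open>z\<close> to the commutator of the two
  difference operators: the first term moves \<open>z\<close> first, the second one moves \<open>x\<close> first.\<close>

definition path_coeff :: "int \<Rightarrow> int \<Rightarrow> int \<Rightarrow> int \<Rightarrow> int \<Rightarrow> int \<Rightarrow> int \<Rightarrow> int \<Rightarrow> complex" where
  "path_coeff d \<epsilon> \<eta> \<delta> \<zeta> I J L =
     q * (move_coeff d \<eta> \<zeta> L J I * bracket_coeff d \<epsilon> \<delta> I (J - 2 * \<zeta>) (L - 2 * \<eta>))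
     - bracket_coeff d \<epsilon> \<delta> I J L * move_coeff d \<eta> \<zeta> L (J - 2 * \<delta>) (I - 2 * \<epsilon>) / q"

text \<open>The monomials in the two orders differ by \<open>q\<^sup>2\<close>, which the weights \<open>q\<close> and \<open>1/q\<close> of the \<open>q\<close>-commutator
  compensate.\<close>

lemma path_coeff_same:
  assumes "\<epsilon> \<in> {1, -1}" "\<delta> \<in> {1, -1}" "\<eta> \<in> {1, -1}"
  shows "path_coeff d \<epsilon> \<eta> \<delta> \<delta> I J L = 0"
proof -
  have "\<delta> * (J - 2 * \<delta>) - \<epsilon> * I = (\<delta> * J - \<epsilon> * I) - 2" using assms(2) by auto
  then have p: "q powi (\<delta> * (J - 2 * \<delta>) - \<epsilon> * I) = q powi (\<delta> * J - \<epsilon> * I) / q^2"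
    using q_nonzero power_int_diff[of q "\<delta> * J - \<epsilon> * I" 2] by (simp only:) simp
  let ?c = "- of_int (\<epsilon> * \<delta>) * qs 2 ^ 2 * q powi (\<delta> * J - \<epsilon> * I) / q"
  have "path_coeff d \<epsilon> \<eta> \<delta> \<delta> I J L
     = ?c * (move_coeff d \<eta> \<delta> L J I * move_coeff d \<epsilon> \<delta> I (J - 2 * \<delta>) (L - 2 * \<eta>))
     - ?c * (move_coeff d \<epsilon> \<delta> I J L * move_coeff d \<eta> \<delta> L (J - 2 * \<delta>) (I - 2 * \<epsilon>))"
    unfolding path_coeff_def bracket_coeff_def p using q_nonzero
    by (simp add: field_simps power2_eq_square)
  then show ?thesis unfolding move_coeff_commute[OF assms] by simp
qed

text \<open>The two pairs of moves that leave \<open>\<partial>(z,x)\<close> unchanged combine to the count of the neighbours of \<open>y\<close>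
  at distances \<open>\<partial>(x,y) + \<epsilon>\<close> and \<open>\<partial>(y,z) + \<eta>\<close>; the factor \<open>q^(-\<eta>L)\<close> is removed by the last commutator.\<close>

lemma path_coeff_opposite:
  assumes "\<epsilon> \<in> {1, -1}" "\<eta> \<in> {1, -1}"
  shows "path_coeff d \<epsilon> \<eta> 1 (-1) I J L + path_coeff d \<epsilon> \<eta> (-1) 1 I J L
       = of_int \<eta> * q * qs 2 ^ 3 * q powi (- \<eta> * L) * move_coeff d \<epsilon> \<eta> I L J"
proof -
  define A B C w where "A = q powi (\<epsilon> * I)" and "B = q powi J" and "C = q powi (\<eta> * L)"
    and "w = q powi d"
  define e h \<tau> where "e = (of_int \<epsilon> :: complex)" and "h = (of_int \<eta> :: complex)" and "\<tau> = e * h"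
  have nz: "A \<noteq> 0" "B \<noteq> 0" "C \<noteq> 0" "w \<noteq> 0"
    using q_nonzero by (auto simp: A_def B_def C_def w_def)
  have sq: "e * e = 1" "h * h = 1" "\<tau>\<^sup>2 = 1" using assms by (auto simp: e_def h_def \<tau>_def)
  have "h = e * \<tau>" using assms by (auto simp: e_def h_def \<tau>_def)
  have I: "qs I = e * lsub A" "qs (I - 2 * \<epsilon>) = e * lsub (A / q^2)" "qc I = ladd A"
    using assms(1) q_nonzero by (auto simp: e_def A_def qs_lsub qc_ladd lsub_def ladd_def power_int_minus
        power_int_add power_int_diff field_simps)
  have L: "qs L = h * lsub C" "qs (L - 2 * \<eta>) = h * lsub (C / q^2)" "qc L = ladd C"
    using assms(2) q_nonzero by (auto simp: h_def C_def qs_lsub qc_ladd lsub_def ladd_def power_int_minus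
        power_int_add power_int_diff field_simps)
  have J: "qc J = ladd B" "qc (J + 2) = ladd (B * q^2)" "qc (J - 2) = ladd (q^2 / B)" "qs J = lsub B"
    using q_nonzero by (auto simp: B_def qs_lsub qc_ladd ladd_def power_int_add power_int_diff field_simps)
  have ladd_nz: "ladd A \<noteq> 0" "ladd B \<noteq> 0" "ladd C \<noteq> 0" "ladd (B * q^2) \<noteq> 0" "ladd (q^2 / B) \<noteq> 0"
    using qc_nonzero by (simp_all flip: I L J)
  note p = power_int_add power_int_diff power_int_minus
  have arg: "qs (d + \<eta> * L + - 1 * J) = lsub (w * C / B)" "qs (d + \<eta> * L + 1 * J) = lsub (w * C * B)"
    "qs (d + \<epsilon> * I + 1 * J) = lsub (w * A * B)" "qs (d + \<epsilon> * I + - 1 * J) = lsub (w * A / B)"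
    "qs (d + \<epsilon> * I + 1 * (J - 2 * - 1)) = lsub (w * A * B * q^2)"
    "qs (d + \<epsilon> * I + - 1 * (J - 2 * 1)) = lsub (w * A / B * q^2)"
    "qs (d + \<eta> * L + - 1 * (J - 2 * 1)) = lsub (w * C / B * q^2)"
    "qs (d + \<eta> * L + 1 * (J - 2 * - 1)) = lsub (w * C * B * q^2)"
    "qs (d + \<epsilon> * I + \<eta> * L) = lsub (w * A * C)"
    using q_nonzero by (simp_all add: qs_lsub p A_def B_def C_def w_def field_simps)
  have pw: "q powi (1 * (J - 2 * - 1) - \<epsilon> * I) = B * q^2 / A" "q powi (1 * J - \<epsilon> * I) = B / A"
    "q powi (- 1 * (J - 2 * 1) - \<epsilon> * I) = q^2 / (B * A)" "q powi (- 1 * J - \<epsilon> * I) = 1 / (B * A)"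
    "q powi (- \<eta> * L) = 1 / C"
    using q_nonzero by (simp_all add: p A_def B_def C_def field_simps)
  let ?k = "- e * qs 2 ^ 2 / A / (ladd C * ladd B * ladd A)"
  have 1: "path_coeff d \<epsilon> \<eta> 1 (-1) I J L = ?k * (B * (q^3 * (path_num w q \<tau> A C B / ladd (B * q^2))
              - path_num w q (- \<tau>) C A (1 / B) / ladd (q^2 / B) / q))"
  proof -
    have m: "move_coeff d \<eta> (-1) L J I = (lsub (w * C / B) - \<tau> * lsub A) / (ladd C * ladd B)"
      "move_coeff d \<epsilon> 1 I (J - 2 * -1) (L - 2 * \<eta>)
        = (lsub (w * A * B * q^2) + \<tau> * lsub (C / q^2)) / (ladd A * ladd (B * q^2))"
      "move_coeff d \<epsilon> 1 I J L = (lsub (w * A * B) + \<tau> * lsub C) / (ladd A * ladd B)"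
      "move_coeff d \<eta> (-1) L (J - 2 * 1) (I - 2 * \<epsilon>)
        = (lsub (w * C / B * q^2) - \<tau> * lsub (A / q^2)) / (ladd C * ladd (q^2 / B))"
      unfolding move_coeff_def arg I L J using J(2,3) by (simp_all add: \<tau>_def e_def h_def)
    show ?thesis
      unfolding path_coeff_def bracket_coeff_def m pw path_num_def using ladd_nz nz q_nonzero
      by (simp add: e_def field_simps power2_eq_square power3_eq_cube)
  qed
  have 2: "path_coeff d \<epsilon> \<eta> (-1) 1 I J L = - ?k * (1 / B * (q^3 * (path_num w q (- \<tau>) A C (1 / B) / ladd (q^2 / B))
              - path_num w q \<tau> C A B / ladd (B * q^2) / q))"
  proof -
    have m: "move_coeff d \<eta> 1 L J I = (lsub (w * C * B) + \<tau> * lsub A) / (ladd C * ladd B)"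
      "move_coeff d \<epsilon> (-1) I (J - 2 * 1) (L - 2 * \<eta>)
        = (lsub (w * A / B * q^2) - \<tau> * lsub (C / q^2)) / (ladd A * ladd (q^2 / B))"
      "move_coeff d \<epsilon> (-1) I J L = (lsub (w * A / B) - \<tau> * lsub C) / (ladd A * ladd B)"
      "move_coeff d \<eta> 1 L (J - 2 * -1) (I - 2 * \<epsilon>)
        = (lsub (w * C * B * q^2) + \<tau> * lsub (A / q^2)) / (ladd C * ladd (B * q^2))"
      unfolding move_coeff_def arg I L J using J(2,3) by (simp_all add: \<tau>_def e_def h_def)
    show ?thesis
      unfolding path_coeff_def bracket_coeff_def m pw path_num_def using ladd_nz nz q_nonzero
      by (simp add: e_def field_simps power2_eq_square power3_eq_cube)
  qed
  have "path_coeff d \<epsilon> \<eta> 1 (-1) I J L + path_coeff d \<epsilon> \<eta> (-1) 1 I J L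
    = ?k * (- \<tau> * q * (A / C) * lsub (q^2) * ladd B * (lsub (w * A * C) + \<tau> * lsub B))"
    unfolding two_path_identity[OF nz(1-4) q_nonzero sq(3) ladd_nz(4,5), symmetric] 1 2
    by (simp add: algebra_simps)
  also have "\<dots> = e * \<tau> * q * qs 2 ^ 2 * lsub (q^2) / C * ((lsub (w * A * C) + \<tau> * lsub B) / (ladd A * ladd C))"
    using ladd_nz nz by (simp add: field_simps)
  also have "\<dots> = h * q * qs 2 ^ 3 * (1 / C) * move_coeff d \<epsilon> \<eta> I L J"
    using qs_lsub[of 2] unfolding \<open>h = e * \<tau>\<close>[symmetric] move_coeff_def arg I L J
    by (simp add: \<tau>_def e_def h_def power3_eq_cube power2_eq_square)
  finally show ?thesis unfolding pw h_def .
qed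

text \<open>The arguments \<open>i, h, j\<close> of a grid function play the roles of \<open>\<partial>(x,y)\<close>, \<open>\<partial>(y,z)\<close>, \<open>\<partial>(z,x)\<close>. All
  integers are admitted: the denominators \<open>{n}\<close> never vanish, so no boundary cases arise.\<close>

definition x_move :: "int \<Rightarrow> grid_fun \<Rightarrow> grid_fun" where
  "x_move d g = (\<lambda>i h j. \<Sum>\<epsilon>\<in>{1, -1}. \<Sum>\<delta>\<in>{1, -1}.
     move_coeff d \<epsilon> \<delta> (d - 2 * i) (d - 2 * j) (d - 2 * h) * g (i + \<epsilon>) h (j + \<delta>))"

definition y_move :: "int \<Rightarrow> grid_fun \<Rightarrow> grid_fun" where
  "y_move d g = (\<lambda>i h j. \<Sum>\<epsilon>\<in>{1, -1}. \<Sum>\<eta>\<in>{1, -1}.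
     move_coeff d \<epsilon> \<eta> (d - 2 * i) (d - 2 * h) (d - 2 * j) * g (i + \<epsilon>) (h + \<eta>) j)"

definition z_move :: "int \<Rightarrow> grid_fun \<Rightarrow> grid_fun" where
  "z_move d g = (\<lambda>i h j. \<Sum>\<eta>\<in>{1, -1}. \<Sum>\<zeta>\<in>{1, -1}.
     move_coeff d \<eta> \<zeta> (d - 2 * h) (d - 2 * j) (d - 2 * i) * g i (h + \<eta>) (j + \<zeta>))"

definition xy_mult :: "int \<Rightarrow> grid_fun \<Rightarrow> grid_fun" where
  "xy_mult d g = (\<lambda>i h j. qs (d - 2 * i) * g i h j)"

definition yz_mult :: "int \<Rightarrow> grid_fun \<Rightarrow> grid_fun" where
  "yz_mult d g = (\<lambda>i h j. qs (d - 2 * h) * g i h j)"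

definition zx_mult :: "int \<Rightarrow> grid_fun \<Rightarrow> grid_fun" where
  "zx_mult d g = (\<lambda>i h j. qs (d - 2 * j) * g i h j)"

definition grid_qcomm :: "(grid_fun \<Rightarrow> grid_fun) \<Rightarrow> (grid_fun \<Rightarrow> grid_fun) \<Rightarrow> grid_fun \<Rightarrow> grid_fun" where
  "grid_qcomm F G g = (\<lambda>i h j. q * F (G g) i h j - G (F g) i h j / q)"

lemma shifted_arg: "d - 2 * (n + s) = d - 2 * n - 2 * s" for d n s :: int
  by simp

lemma double_bracket:
  "grid_qcomm (zx_mult d) (grid_qcomm (x_move d) (xy_mult d)) g i h j
   = (\<Sum>\<epsilon>\<in>{1, -1}. \<Sum>\<delta>\<in>{1, -1}.
       bracket_coeff d \<epsilon> \<delta> (d - 2 * i) (d - 2 * j) (d - 2 * h) * g (i + \<epsilon>) h (j + \<delta>))"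
proof -
  define I J L where "I = d - 2 * i" and "J = d - 2 * j" and "L = d - 2 * h"
  have "grid_qcomm (zx_mult d) (grid_qcomm (x_move d) (xy_mult d)) g i h j
    = (\<Sum>\<epsilon>\<in>{1, -1}. \<Sum>\<delta>\<in>{1, -1}. (q * qs J - qs (J - 2 * \<delta>) / q) * (q * qs (I - 2 * \<epsilon>) - qs I / q)
         * move_coeff d \<epsilon> \<delta> I J L * g (i + \<epsilon>) h (j + \<delta>))"
    unfolding grid_qcomm_def zx_mult_def x_move_def xy_mult_def shifted_arg
      I_def[symmetric] J_def[symmetric] L_def[symmetric] sum_signs
    by (simp only: algebra_simps diff_divide_distrib add_divide_distrib times_divide_eq_left times_divide_eq_right)
  also have "\<dots> = (\<Sum>\<epsilon>\<in>{1, -1}. \<Sum>\<delta>\<in>{1, -1}. bracket_coeff d \<epsilon> \<delta> I J L * g (i + \<epsilon>) h (j + \<delta>))"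
  proof (intro sum.cong refl)
    fix \<epsilon> \<delta> :: int assume s: "\<epsilon> \<in> {1, -1}" "\<delta> \<in> {1, -1}"
    have "q powi (\<delta> * J - \<epsilon> * I) = q powi (\<delta> * J) * q powi (- \<epsilon> * I)"
      using q_nonzero by (simp flip: power_int_add)
    then show "(q * qs J - qs (J - 2 * \<delta>) / q) * (q * qs (I - 2 * \<epsilon>) - qs I / q)
         * move_coeff d \<epsilon> \<delta> I J L * g (i + \<epsilon>) h (j + \<delta>)
       = bracket_coeff d \<epsilon> \<delta> I J L * g (i + \<epsilon>) h (j + \<delta>)"
      unfolding bracket_after[OF s(1)] bracket_before[OF s(2)] bracket_coeff_def
      using q_nonzero by (simp add: power2_eq_square)
  qed
  finally show ?thesis unfolding I_def J_def L_def .
qed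

lemma triple_bracket:
  "grid_qcomm (z_move d) (grid_qcomm (zx_mult d) (grid_qcomm (x_move d) (xy_mult d))) g i h j
   = (\<Sum>\<epsilon>\<in>{1, -1}. \<Sum>\<eta>\<in>{1, -1}. of_int \<eta> * q * qs 2 ^ 3 * q powi (- \<eta> * (d - 2 * h)) *
       move_coeff d \<epsilon> \<eta> (d - 2 * i) (d - 2 * h) (d - 2 * j) * g (i + \<epsilon>) (h + \<eta>) j)"
proof -
  define I J L where "I = d - 2 * i" and "J = d - 2 * j" and "L = d - 2 * h"
  have "grid_qcomm (z_move d) (grid_qcomm (zx_mult d) (grid_qcomm (x_move d) (xy_mult d))) g i h j
    = (\<Sum>\<epsilon>\<in>{1, -1}. \<Sum>\<eta>\<in>{1, -1}. \<Sum>\<delta>\<in>{1, -1}. \<Sum>\<zeta>\<in>{1, -1}.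
        path_coeff d \<epsilon> \<eta> \<delta> \<zeta> I J L * g (i + \<epsilon>) (h + \<eta>) (j + (\<delta> + \<zeta>)))"
    unfolding grid_qcomm_def[of "z_move d"] double_bracket z_move_def shifted_arg path_coeff_def
      I_def[symmetric] J_def[symmetric] L_def[symmetric] sum_signs
    by (simp add: algebra_simps diff_divide_distrib add_divide_distrib)
  also have "\<dots> = (\<Sum>\<epsilon>\<in>{1, -1}. \<Sum>\<eta>\<in>{1, -1}.
        (path_coeff d \<epsilon> \<eta> 1 (-1) I J L + path_coeff d \<epsilon> \<eta> (-1) 1 I J L) * g (i + \<epsilon>) (h + \<eta>) j)"
    by (intro sum.cong refl) (simp only: sum_signs, simp add: path_coeff_same algebra_simps)
  also have "\<dots> = (\<Sum>\<epsilon>\<in>{1, -1}. \<Sum>\<eta>\<in>{1, -1}. of_int \<eta> * q * qs 2 ^ 3 * q powi (- \<eta> * L) *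
       move_coeff d \<epsilon> \<eta> I L J * g (i + \<epsilon>) (h + \<eta>) j)"
    by (intro sum.cong refl) (simp only: path_coeff_opposite)
  finally show ?thesis unfolding I_def J_def L_def .
qed

text \<open>Up to the normalisation of the generators, this is the relation that defines \<open>B\<^sub>6\<close>, with \<open>B\<^sub>1, B\<^sub>3, B\<^sub>5\<close>
  as the multiplications and \<open>B\<^sub>2, B\<^sub>4, B\<^sub>6\<close> as the moves of \<open>z\<close>, \<open>x\<close>, \<open>y\<close>.\<close>

theorem quadruple_bracket:
  "grid_qcomm (yz_mult d) (grid_qcomm (z_move d) (grid_qcomm (zx_mult d) (grid_qcomm (x_move d) (xy_mult d)))) g
   = (\<lambda>i h j. qs 2 ^ 4 * y_move d g i h j)"
proof (intro ext)
  fix i h j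
  define I J L where "I = d - 2 * i" and "J = d - 2 * j" and "L = d - 2 * h"
  have "grid_qcomm (yz_mult d) (grid_qcomm (z_move d) (grid_qcomm (zx_mult d) (grid_qcomm (x_move d) (xy_mult d)))) g i h j
    = (\<Sum>\<epsilon>\<in>{1, -1}. \<Sum>\<eta>\<in>{1, -1}. (q * qs L - qs (L - 2 * \<eta>) / q) *
        (of_int \<eta> * q * qs 2 ^ 3 * q powi (- \<eta> * L) * move_coeff d \<epsilon> \<eta> I L J * g (i + \<epsilon>) (h + \<eta>) j))"
    unfolding grid_qcomm_def[of "yz_mult d"] triple_bracket yz_mult_def shifted_arg
      I_def[symmetric] J_def[symmetric] L_def[symmetric] sum_signs
    by (simp only: algebra_simps diff_divide_distrib add_divide_distrib times_divide_eq_left times_divide_eq_right)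
  also have "\<dots> = (\<Sum>\<epsilon>\<in>{1, -1}. \<Sum>\<eta>\<in>{1, -1}. qs 2 ^ 4 * (move_coeff d \<epsilon> \<eta> I L J * g (i + \<epsilon>) (h + \<eta>) j))"
  proof (intro sum.cong refl)
    fix \<epsilon> \<eta> :: int assume s: "\<epsilon> \<in> {1, -1}" "\<eta> \<in> {1, -1}"
    have regroup: "(e / q * qs 2 * a) * (e * q * qs 2 ^ 3 * b) = (e * e) * (a * b) * qs 2 ^ 4" for e a b
      using q_nonzero by (simp add: power3_eq_cube power4_eq_xxxx)
    have "q powi (\<eta> * L) * q powi (- \<eta> * L) = 1" "of_int \<eta> * of_int \<eta> = (1::complex)"
      using q_nonzero s(2) by (auto simp flip: power_int_add)
    then have "(q * qs L - qs (L - 2 * \<eta>) / q) * (of_int \<eta> * q * qs 2 ^ 3 * q powi (- \<eta> * L)) = qs 2 ^ 4"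
      using regroup[of "of_int \<eta>" "q powi (\<eta> * L)" "q powi (- \<eta> * L)"]
      unfolding bracket_before[OF s(2)] by simp
    then have "(q * qs L - qs (L - 2 * \<eta>) / q) * (of_int \<eta> * q * qs 2 ^ 3 * q powi (- \<eta> * L)) *
        (move_coeff d \<epsilon> \<eta> I L J * g (i + \<epsilon>) (h + \<eta>) j)
      = qs 2 ^ 4 * (move_coeff d \<epsilon> \<eta> I L J * g (i + \<epsilon>) (h + \<eta>) j)" by (rule arg_cong)
    then show "(q * qs L - qs (L - 2 * \<eta>) / q) *
        (of_int \<eta> * q * qs 2 ^ 3 * q powi (- \<eta> * L) * move_coeff d \<epsilon> \<eta> I L J * g (i + \<epsilon>) (h + \<eta>) j)
       = qs 2 ^ 4 * (move_coeff d \<epsilon> \<eta> I L J * g (i + \<epsilon>) (h + \<eta>) j)" by (simp only: mult.assoc)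
  qed
  finally show "grid_qcomm (yz_mult d) (grid_qcomm (z_move d) (grid_qcomm (zx_mult d) (grid_qcomm (x_move d) (xy_mult d)))) g i h j
     = qs 2 ^ 4 * y_move d g i h j"
    by (simp only: y_move_def I_def J_def L_def sum_distrib_left)
qed
end

section \<open>Modules over the algebra with generators and relations\<close>

definition word_action :: "('g \<Rightarrow> 'v \<Rightarrow> 'v) \<Rightarrow> 'g word \<Rightarrow> 'v \<Rightarrow> 'v" where
  "word_action B w = foldr B (letters w)"

lemma word_action_zero: "word_action B 0 v = v"
  and word_action_plus: "word_action B (w + w') v = word_action B w (word_action B w' v)"
  by (simp_all add: word_action_def zero_word_def plus_word_def)

definition free_action :: "('g \<Rightarrow> complex^'n \<Rightarrow> complex^'n) \<Rightarrow> 'g free_alg \<Rightarrow> complex^'n \<Rightarrow> complex^'n" where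
  "free_action B f v = (\<Sum>w\<in>Poly_Mapping.keys f. Poly_Mapping.lookup f w *s word_action B w v)"

locale linear_generators =
  fixes B :: "'g \<Rightarrow> complex^'n \<Rightarrow> complex^'n"
  assumes B_add: "B g (v + w) = B g v + B g w" and B_scale: "B g (c *s v) = c *s B g v"
begin

lemma word_action_add: "word_action B w (u + v) = word_action B w u + word_action B w v"
  and word_action_scale: "word_action B w (c *s v) = c *s word_action B w v"
proof -
  have "foldr B xs (u + v) = foldr B xs u + foldr B xs v" "foldr B xs (c *s v) = c *s foldr B xs v" for xs
    by (induction xs) (simp_all add: B_add B_scale)
  then show "word_action B w (u + v) = word_action B w u + word_action B w v"
    "word_action B w (c *s v) = c *s word_action B w v" by (simp_all add: word_action_def)
qed

lemma free_action_superset: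
  assumes "finite S" "Poly_Mapping.keys f \<subseteq> S"
  shows "free_action B f v = (\<Sum>w\<in>S. Poly_Mapping.lookup f w *s word_action B w v)"
  unfolding free_action_def using assms
  by (intro sum.mono_neutral_left) (auto simp: in_keys_iff)

lemma free_action_plus: "free_action B (f + f') v = free_action B f v + free_action B f' v"
proof -
  let ?S = "Poly_Mapping.keys f \<union> Poly_Mapping.keys f'"
  have "free_action B (f + f') v = (\<Sum>w\<in>?S. Poly_Mapping.lookup (f + f') w *s word_action B w v)"
    by (rule free_action_superset) (use Poly_Mapping.keys_add[of f f'] in auto)
  also have "\<dots> = (\<Sum>w\<in>?S. Poly_Mapping.lookup f w *s word_action B w v)
      + (\<Sum>w\<in>?S. Poly_Mapping.lookup f' w *s word_action B w v)"
    by (simp add: lookup_add vec.scale_left_distrib sum.distrib)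
  also have "\<dots> = free_action B f v + free_action B f' v"
    by (simp add: free_action_superset[of ?S])
  finally show ?thesis .
qed

lemma free_action_zero: "free_action B 0 v = 0"
  by (simp add: free_action_def)

lemma free_action_single: "free_action B (Poly_Mapping.single w c) v = c *s word_action B w v"
  by (simp add: free_action_def)

lemma free_action_uminus: "free_action B (- f) v = - free_action B f v"
  using free_action_plus[of f "- f" v] by (simp add: free_action_zero eq_neg_iff_add_eq_0 add.commute)

lemma free_action_minus: "free_action B (f - f') v = free_action B f v - free_action B f' v"
  using free_action_plus[of f "- f'" v] by (simp add: free_action_uminus)

lemma free_action_sum: "free_action B (sum F S) v = (\<Sum>s\<in>S. free_action B (F s) v)"
  by (induction S rule: infinite_finite_induct) (simp_all add: free_action_zero free_action_plus)

lemma free_action_add: "free_action B f (u + v) = free_action B f u + free_action B f v"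
  and free_action_scale: "free_action B f (c *s v) = c *s free_action B f v"
  by (simp_all add: free_action_def word_action_add word_action_scale vec.scale_right_distrib
      sum.distrib vec.scale_sum_right ac_simps)

lemma free_action_vec_zero: "free_action B f 0 = 0"
  using free_action_scale[of f 0 0] by simp

lemma free_action_vec_sum: "free_action B f (sum V S) = (\<Sum>s\<in>S. free_action B f (V s))"
  by (induction S rule: infinite_finite_induct) (simp_all add: free_action_vec_zero free_action_add)

lemma free_action_times: "free_action B (f * f') v = free_action B f (free_action B f' v)"
proof -
  have single: "free_action B (Poly_Mapping.single w c * Poly_Mapping.single w' c') v
      = free_action B (Poly_Mapping.single w c) (free_action B (Poly_Mapping.single w' c') v)" for w c w' c'
    by (simp add: mult_single free_action_single word_action_plus word_action_scale)
  have expand: "f = (\<Sum>w\<in>Poly_Mapping.keys f. Poly_Mapping.single w (Poly_Mapping.lookup f w))" for f :: "'g free_alg"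
    by (rule poly_mapping_eqI) (simp add: lookup_sum lookup_single when_def in_keys_iff)
  show ?thesis
    by (subst (1 2) expand[of f], subst (1 2) expand[of f'])
      (simp only: sum_distrib_left sum_distrib_right free_action_sum free_action_vec_sum single)
qed

lemma free_action_one: "free_action B 1 v = v"
  using free_action_single[of 0 1 v] by (simp add: word_action_zero single_one)

lemma free_action_scalar: "free_action B (scalar c) v = c *s v"
  by (simp add: scalar_def free_action_single word_action_zero)

lemma free_action_gen: "free_action B (gen g) v = B g v"
  by (simp add: gen_def free_action_single word_action_def)

lemma free_action_closed:
  assumes "vec.subspace L" "f \<in> carrier (free_algebra G)"
    and "\<And>g v. g \<in> G \<Longrightarrow> v \<in> L \<Longrightarrow> B g v \<in> L" and "v \<in> L"
  shows "free_action B f v \<in> L"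
proof -
  have "foldr B xs v \<in> L" if "set xs \<subseteq> G" for xs
    using that by (induction xs) (simp_all add: assms)
  then have "word_action B w v \<in> L" if "w \<in> Poly_Mapping.keys f" for w
    using that assms(2) by (simp add: word_action_def free_algebra_def)
  then show ?thesis unfolding free_action_def
    by (intro vec.subspace_sum vec.subspace_scale assms(1)) auto
qed

end

lemma letters_zero: "letters 0 = []" and letters_plus: "letters (v + w) = letters v @ letters w"
  by (simp_all add: zero_word_def plus_word_def)

lemma ring_free_algebra: "ring (free_algebra G)"
proof (rule ringI)
  show "abelian_group (free_algebra G)"
  proof (rule abelian_groupI)
    fix f f' assume "f \<in> carrier (free_algebra G)" "f' \<in> carrier (free_algebra G)"
    then show "f \<oplus>\<^bsub>free_algebra G\<^esub> f' \<in> carrier (free_algebra G)"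
      using Poly_Mapping.keys_add[of f f'] by (auto simp: free_algebra_def)
  next
    fix f assume "f \<in> carrier (free_algebra G)"
    then show "\<exists>f'\<in>carrier (free_algebra G). f' \<oplus>\<^bsub>free_algebra G\<^esub> f = \<zero>\<^bsub>free_algebra G\<^esub>"
      by (intro bexI[of _ "- f"]) (auto simp: free_algebra_def)
  qed (auto simp: free_algebra_def ac_simps)
  show "monoid (free_algebra G)"
  proof (rule monoidI)
    fix f f' assume f: "f \<in> carrier (free_algebra G)" "f' \<in> carrier (free_algebra G)"
    have "set (letters w) \<subseteq> G" if "w \<in> Poly_Mapping.keys (f * f')" for w
    proof -
      have "w \<in> {a + b | a b. a \<in> Poly_Mapping.keys f \<and> b \<in> Poly_Mapping.keys f'}"
        using keys_mult[of f f'] that by blast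
      then obtain a b where "w = a + b" "a \<in> Poly_Mapping.keys f" "b \<in> Poly_Mapping.keys f'"
        by blast
      then show ?thesis using f by (auto simp: free_algebra_def letters_plus)
    qed
    then show "f \<otimes>\<^bsub>free_algebra G\<^esub> f' \<in> carrier (free_algebra G)" by (auto simp: free_algebra_def)
  next
    have "Poly_Mapping.keys (1 :: 'a free_alg) = {0}" by simp
    then show "\<one>\<^bsub>free_algebra G\<^esub> \<in> carrier (free_algebra G)" by (simp add: free_algebra_def letters_zero)
  qed (auto simp: free_algebra_def mult.assoc)
qed (auto simp: free_algebra_def algebra_simps)

lemma scalar_in_carrier: "scalar c \<in> carrier (free_algebra G)"
  by (auto simp: free_algebra_def scalar_def letters_zero)

lemma gen_in_carrier: "g \<in> G \<Longrightarrow> gen g \<in> carrier (free_algebra G)"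
  by (auto simp: free_algebra_def gen_def)

lemma a_inv_free_algebra: "f \<in> carrier (free_algebra G) \<Longrightarrow> \<ominus>\<^bsub>free_algebra G\<^esub> f = - f"
proof -
  interpret ring "free_algebra G" by (rule ring_free_algebra)
  assume f: "f \<in> carrier (free_algebra G)"
  then have "- f \<in> carrier (free_algebra G)" by (simp add: free_algebra_def)
  with f show ?thesis by (intro minus_equality) (simp_all add: free_algebra_def)
qed

lemma free_algebra_closed_uminus: "f \<in> carrier (free_algebra G) \<Longrightarrow> - f \<in> carrier (free_algebra G)"
  by (simp add: free_algebra_def)

lemma free_algebra_closed:
  assumes "f \<in> carrier (free_algebra G)" "f' \<in> carrier (free_algebra G)"
  shows "f * f' \<in> carrier (free_algebra G)" "f + f' \<in> carrier (free_algebra G)"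
    "f - f' \<in> carrier (free_algebra G)"
proof -
  interpret ring "free_algebra G" by (rule ring_free_algebra)
  show "f * f' \<in> carrier (free_algebra G)" "f + f' \<in> carrier (free_algebra G)"
    using m_closed[OF assms] a_closed[OF assms] by (simp_all add: free_algebra_def)
  have "- f' \<in> carrier (free_algebra G)" using assms(2) by (simp add: free_algebra_def)
  from a_closed[OF assms(1) this] show "f - f' \<in> carrier (free_algebra G)"
    by (simp add: free_algebra_def)
qed

lemma relators_in_carrier: "so6_relators q \<subseteq> carrier (free_algebra {1..5})"
proof
  fix f assume "f \<in> so6_relators q"
  then consider (serre) i j where "i \<in> {1..5}" "j \<in> {1..5}"
      "f = gen i * gen i * gen j - scalar (q powi 2 + q powi (-2)) * (gen i * gen j * gen i)
        + gen j * gen i * gen i - (- gen j)"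
    | (commute) i j where "i \<in> {1..5}" "j \<in> {1..5}" "f = gen i * gen j - gen j * gen i"
    unfolding so6_relators_def by blast
  then show "f \<in> carrier (free_algebra {1..5})"
  proof cases
    case serre
    then show ?thesis
      by (simp only:) (intro free_algebra_closed free_algebra_closed_uminus scalar_in_carrier gen_in_carrier)
  next
    case commute
    then show ?thesis by (simp only:) (intro free_algebra_closed gen_in_carrier)
  qed
qed

lemma ideal_so6: "ideal (so6_ideal q) (free_algebra {1..5})"
  unfolding so6_ideal_def by (rule ring.genideal_ideal[OF ring_free_algebra relators_in_carrier])

context complex_algebra_module begin

lemma act_zero: "v \<in> L \<Longrightarrow> act \<zero> v = 0"
  using act_add_left[of \<zero> \<zero> v] by simp

lemma act_uminus: "a \<in> carrier U \<Longrightarrow> v \<in> L \<Longrightarrow> act (\<ominus> a) v = - act a v"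
  using act_add_left[of "\<ominus> a" a v] act_zero[of v] by (simp add: l_neg eq_neg_iff_add_eq_0)

lemma act_minus: "a \<in> carrier U \<Longrightarrow> b \<in> carrier U \<Longrightarrow> v \<in> L \<Longrightarrow> act (a \<ominus> b) v = act a v - act b v"
  by (simp add: a_minus_def act_add_left act_uminus)

end

definition op_qcomm ::
  "complex \<Rightarrow> (complex^'n \<Rightarrow> complex^'n) \<Rightarrow> (complex^'n \<Rightarrow> complex^'n) \<Rightarrow> complex^'n \<Rightarrow> complex^'n" where
  "op_qcomm q F G v = q *s F (G v) - q powi (-1) *s G (F v)"

locale so6_representation = linear_generators B
  for B :: "nat \<Rightarrow> complex^'n \<Rightarrow> complex^'n" +
  fixes q :: complex and L :: "(complex^'n) set"
  assumes subspace_L: "vec.subspace L"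
    and B_closed: "i \<in> {1..5} \<Longrightarrow> v \<in> L \<Longrightarrow> B i v \<in> L"
    and serre: "\<lbrakk>i \<in> {1..5}; j \<in> {1..5}; \<bar>int i - int j\<bar> = 1; v \<in> L\<rbrakk> \<Longrightarrow>
      B i (B i (B j v)) - (q powi 2 + q powi (-2)) *s B i (B j (B i v)) + B j (B i (B i v)) = - B j v"
    and commute: "\<lbrakk>i \<in> {1..5}; j \<in> {1..5}; \<bar>int i - int j\<bar> \<ge> 2; v \<in> L\<rbrakk> \<Longrightarrow> B i (B j v) = B j (B i v)"
begin

text \<open>The elements of the free algebra that annihilate \<open>L\<close> form an ideal, because \<open>L\<close> is invariant, and this
  ideal contains the relators.\<close>

lemma so6_ideal_acts_as_zero:
  assumes "f \<in> so6_ideal q" "v \<in> L"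
  shows "free_action B f v = 0"
proof -
  let ?R = "free_algebra {1..5::nat}"
  let ?I = "{f \<in> carrier ?R. \<forall>v\<in>L. free_action B f v = 0}"
  interpret ring ?R by (rule ring_free_algebra)
  have simps: "f \<oplus>\<^bsub>?R\<^esub> f' = f + f'" "f \<otimes>\<^bsub>?R\<^esub> f' = f * f'" "\<zero>\<^bsub>?R\<^esub> = 0" for f f' by (simp_all add: free_algebra_def)
  have closed: "free_action B f v \<in> L" if "f \<in> carrier ?R" "v \<in> L" for f v
    using that subspace_L B_closed by (intro free_action_closed)
  have "ideal ?I ?R"
  proof (rule idealI)
    show "subgroup ?I (add_monoid ?R)"
    proof (rule add.subgroupI)
      show "?I \<noteq> {}" using zero_closed by (auto simp: simps free_action_zero simp del: One_nat_def)
      fix f assume f: "f \<in> ?I"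
      then have "\<ominus>\<^bsub>?R\<^esub> f = - f" by (simp add: a_inv_free_algebra del: One_nat_def)
      then show "\<ominus>\<^bsub>?R\<^esub> f \<in> ?I" using f a_inv_closed[of f] by (simp add: free_action_uminus del: One_nat_def)
    next
      fix f f' assume "f \<in> ?I" "f' \<in> ?I"
      then show "f \<oplus>\<^bsub>?R\<^esub> f' \<in> ?I" using a_closed[of f f'] by (simp add: simps free_action_plus del: One_nat_def)
    qed auto
  next
    fix f g assume "f \<in> ?I" "g \<in> carrier ?R"
    then show "g \<otimes>\<^bsub>?R\<^esub> f \<in> ?I" "f \<otimes>\<^bsub>?R\<^esub> g \<in> ?I"
      using m_closed[of f g] m_closed[of g f] closed
      by (auto simp: simps free_action_times free_action_vec_zero simp del: One_nat_def)
  qed (rule ring_free_algebra)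
  moreover have "so6_relators q \<subseteq> ?I"
  proof
    fix f assume f: "f \<in> so6_relators q"
    have "free_action B f v = 0" if "v \<in> L" for v
      using f serre[OF _ _ _ that] commute[OF _ _ _ that] unfolding so6_relators_def
      by (auto simp: free_action_plus free_action_minus free_action_uminus free_action_times
          free_action_gen free_action_scalar mult.assoc)
    then show "f \<in> ?I" using f relators_in_carrier by blast
  qed
  ultimately have "so6_ideal q \<subseteq> ?I" unfolding so6_ideal_def by (rule genideal_minimal)
  then show ?thesis using assms by auto
qed

definition quotient_action :: "nat free_alg set \<Rightarrow> complex^'n \<Rightarrow> complex^'n" where
  "quotient_action a = free_action B (SOME f. f \<in> carrier (free_algebra {1..5}) \<and> U_class q f = a)"

lemma U_class_hom: "U_class q \<in> ring_hom (free_algebra {1..5}) (U_so6 q)"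
proof -
  interpret ideal "so6_ideal q" "free_algebra {1..5}" by (rule ideal_so6)
  show ?thesis using rcos_ring_hom unfolding U_so6_def U_class_def[abs_def] .
qed

lemma carrier_U_so6: "carrier (U_so6 q) = U_class q ` carrier (free_algebra {1..5})"
  by (auto simp: U_so6_def FactRing_def A_RCOSETS_def' U_class_def)

text \<open>Two representatives of a class differ by an element of the ideal, so the choice made in
  \<open>quotient_action\<close> does not matter.\<close>

lemma quotient_action_class:
  assumes f: "f \<in> carrier (free_algebra {1..5})" and v: "v \<in> L"
  shows "quotient_action (U_class q f) v = free_action B f v"
proof -
  interpret ideal "so6_ideal q" "free_algebra {1..5}" by (rule ideal_so6)
  define f' where "f' = (SOME f'. f' \<in> carrier (free_algebra {1..5}) \<and> U_class q f' = U_class q f)"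
  have "f' \<in> carrier (free_algebra {1..5}) \<and> U_class q f' = U_class q f"
    unfolding f'_def by (rule someI_ex) (use f in blast)
  then have f': "f' \<in> carrier (free_algebra {1..5})" "U_class q f' = U_class q f" by auto
  have "f' \<ominus>\<^bsub>free_algebra {1..5}\<^esub> f \<in> so6_ideal q"
    using quotient_eq_iff_same_a_r_cos[OF ideal_axioms f'(1) f] f'(2) by (simp add: U_class_def)
  moreover have "f' \<ominus>\<^bsub>free_algebra {1..5}\<^esub> f = f' - f"
    using f by (simp add: a_minus_def a_inv_free_algebra) (simp add: free_algebra_def)
  ultimately have "free_action B (f' - f) v = 0" using so6_ideal_acts_as_zero v by simp
  then show ?thesis unfolding quotient_action_def f'_def[symmetric] by (simp add: free_action_minus)
qed

theorem quotient_module: "complex_algebra_module (U_so6 q) (U_scalar q) L quotient_action"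
proof -
  let ?R = "free_algebra {1..5::nat}"
  interpret R: ring ?R by (rule ring_free_algebra)
  have "ring (U_so6 q)" unfolding U_so6_def by (rule ideal.quotient_is_ring[OF ideal_so6])
  then interpret U: ring "U_so6 q" .
  have hom: "U_class q (f + f') = U_class q f \<oplus>\<^bsub>U_so6 q\<^esub> U_class q f'"
    "U_class q (f * f') = U_class q f \<otimes>\<^bsub>U_so6 q\<^esub> U_class q f'"
    if "f \<in> carrier ?R" "f' \<in> carrier ?R" for f f'
    using ring_hom_add[OF U_class_hom that] ring_hom_mult[OF U_class_hom that]
    by (simp_all add: free_algebra_def)
  have closed: "f + f' \<in> carrier ?R" "f * f' \<in> carrier ?R" if "f \<in> carrier ?R" "f' \<in> carrier ?R" for f f'
    using R.a_closed[OF that] R.m_closed[OF that] by (simp_all add: free_algebra_def)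
  have action_closed: "free_action B f v \<in> L" if "f \<in> carrier ?R" "v \<in> L" for f v
    using that subspace_L B_closed by (intro free_action_closed)
  have one: "\<one>\<^bsub>U_so6 q\<^esub> = U_class q 1" "1 \<in> carrier ?R"
    using ring_hom_one[OF U_class_hom] R.one_closed by (simp_all add: free_algebra_def)
  show ?thesis
  proof unfold_locales
    show "vec.subspace L" by (rule subspace_L)
  next
    fix a v assume "a \<in> carrier (U_so6 q)" "v \<in> L"
    then show "quotient_action a v \<in> L"
      unfolding carrier_U_so6 by (auto simp: quotient_action_class action_closed)
  next
    fix a v w assume "a \<in> carrier (U_so6 q)" "v \<in> L" "w \<in> L"
    then show "quotient_action a (v + w) = quotient_action a v + quotient_action a w"
      unfolding carrier_U_so6
      by (auto simp: quotient_action_class free_action_add vec.subspace_add[OF subspace_L])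
  next
    fix a b v assume "a \<in> carrier (U_so6 q)" "b \<in> carrier (U_so6 q)" "v \<in> L"
    then show "quotient_action (a \<oplus>\<^bsub>U_so6 q\<^esub> b) v = quotient_action a v + quotient_action b v"
      "quotient_action (a \<otimes>\<^bsub>U_so6 q\<^esub> b) v = quotient_action a (quotient_action b v)"
      unfolding carrier_U_so6
      by (auto simp: quotient_action_class action_closed closed free_action_plus free_action_times
          simp del: One_nat_def simp flip: hom)
  next
    fix v assume "v \<in> L"
    then show "quotient_action \<one>\<^bsub>U_so6 q\<^esub> v = v"
      unfolding one(1) using quotient_action_class[OF one(2)] free_action_one by metis
  next
    fix v c assume "v \<in> L"
    then show "quotient_action (U_scalar q c) v = c *s v"
      unfolding U_scalar_def by (simp add: quotient_action_class scalar_in_carrier free_action_scalar)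
  qed
qed

lemma quotient_action_gen: "i \<in> {1..5} \<Longrightarrow> v \<in> L \<Longrightarrow> quotient_action (U_gen q i) v = B i v"
  unfolding U_gen_def by (simp add: quotient_action_class gen_in_carrier free_action_gen)

lemma quotient_action_qcomm:
  assumes "a \<in> carrier (U_so6 q)" "b \<in> carrier (U_so6 q)" "v \<in> L"
    and "\<And>v. v \<in> L \<Longrightarrow> quotient_action a v = F v" "\<And>v. v \<in> L \<Longrightarrow> quotient_action b v = G v"
  shows "U_qcomm q a b \<in> carrier (U_so6 q)" "quotient_action (U_qcomm q a b) v = op_qcomm q F G v"
proof -
  interpret complex_algebra_module "U_so6 q" "U_scalar q" L quotient_action by (rule quotient_module)
  have scalar: "U_scalar q c \<in> carrier (U_so6 q)" for c
    unfolding U_scalar_def carrier_U_so6 using scalar_in_carrier by blast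
  show "U_qcomm q a b \<in> carrier (U_so6 q)" unfolding U_qcomm_def using assms scalar by simp
  have "F w \<in> L" "G w \<in> L" if "w \<in> L" for w
    using act_closed[of a w] act_closed[of b w] assms that by auto
  then show "quotient_action (U_qcomm q a b) v = op_qcomm q F G v"
    unfolding U_qcomm_def op_qcomm_def using assms scalar
    by (simp add: act_minus act_mult act_scalar act_closed)
qed

lemma quotient_action_B6:
  assumes "v \<in> L"
  shows "quotient_action (U_B6 q) v
    = - op_qcomm q (B 1) (op_qcomm q (B 2) (op_qcomm q (B 3) (op_qcomm q (B 4) (B 5)))) v"
proof -
  interpret complex_algebra_module "U_so6 q" "U_scalar q" L quotient_action by (rule quotient_module)
  have gen: "U_gen q i \<in> carrier (U_so6 q)" if "i \<in> {1..5}" for i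
    unfolding U_gen_def carrier_U_so6 using gen_in_carrier[OF that] by blast
  note gens = gen[of 1] gen[of 2] gen[of 3] gen[of 4] gen[of 5]
    quotient_action_gen[of 1] quotient_action_gen[of 2] quotient_action_gen[of 3]
    quotient_action_gen[of 4] quotient_action_gen[of 5]
  define u45 where "u45 = U_qcomm q (U_gen q 4) (U_gen q 5)"
  define u35 where "u35 = U_qcomm q (U_gen q 3) u45"
  define u25 where "u25 = U_qcomm q (U_gen q 2) u35"
  define u15 where "u15 = U_qcomm q (U_gen q 1) u25"
  have 4: "u45 \<in> carrier (U_so6 q)" "\<And>v. v \<in> L \<Longrightarrow> quotient_action u45 v = op_qcomm q (B 4) (B 5) v"
    unfolding u45_def using quotient_action_qcomm[of "U_gen q 4" "U_gen q 5" _ "B 4" "B 5"] assms gens by auto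
  have 3: "u35 \<in> carrier (U_so6 q)" "\<And>v. v \<in> L \<Longrightarrow> quotient_action u35 v = op_qcomm q (B 3) (op_qcomm q (B 4) (B 5)) v"
    unfolding u35_def using quotient_action_qcomm[of "U_gen q 3" u45 _ "B 3" "op_qcomm q (B 4) (B 5)"] assms gens 4 by auto
  have 2: "u25 \<in> carrier (U_so6 q)" "\<And>v. v \<in> L \<Longrightarrow> quotient_action u25 v = op_qcomm q (B 2) (op_qcomm q (B 3) (op_qcomm q (B 4) (B 5))) v"
    unfolding u25_def using quotient_action_qcomm[of "U_gen q 2" u35 _ "B 2" "op_qcomm q (B 3) (op_qcomm q (B 4) (B 5))"] assms gens 3 by auto
  have 1: "u15 \<in> carrier (U_so6 q)" "quotient_action u15 v = op_qcomm q (B 1) (op_qcomm q (B 2) (op_qcomm q (B 3) (op_qcomm q (B 4) (B 5)))) v"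
    unfolding u15_def using quotient_action_qcomm[of "U_gen q 1" u25 _ "B 1" "op_qcomm q (B 2) (op_qcomm q (B 3) (op_qcomm q (B 4) (B 5)))"] assms gens 2 by auto
  have "U_B6 q = \<ominus>\<^bsub>U_so6 q\<^esub> u15" by (simp add: U_B6_def u15_def u25_def u35_def u45_def)
  then show ?thesis using act_uminus[OF 1(1) assms] 1(2) by simp
qed

end

section \<open>Distances in a distance-regular graph\<close>

locale distance_regular_graph =
  fixes adj :: "'a::finite \<Rightarrow> 'a \<Rightarrow> bool"
  assumes simple: "simple_graph adj" and connected: "graph_connected adj"
    and regular: "distance_regular adj"
begin

abbreviation dist :: "'a \<Rightarrow> 'a \<Rightarrow> nat" where "dist \<equiv> gdist adj"

lemma adj_sym: "adj x y \<longleftrightarrow> adj y x" and adj_irrefl: "\<not> adj x x"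
  using simple by (auto simp: simple_graph_def symp_def irreflp_def)

lemma walk_of_length_dist: "(adj ^^ dist x y) x y"
  using connected unfolding graph_connected_def gdist_def by (metis (mono_tags) LeastI_ex)

lemma dist_le_walk: "(adj ^^ n) x y \<Longrightarrow> dist x y \<le> n"
  unfolding gdist_def by (rule Least_le)

lemma walk_reverse: "(adj ^^ n) x y \<Longrightarrow> (adj ^^ n) y x"
proof (induction n arbitrary: y)
  case (Suc n)
  then obtain w where "(adj ^^ n) x w" "adj w y" by (auto elim: relpowp_Suc_E)
  then show ?case using Suc.IH adj_sym by (blast intro: relpowp_Suc_I2)
qed simp

lemma dist_sym: "dist x y = dist y x"
  by (meson dist_le_walk walk_of_length_dist walk_reverse le_antisym)

lemma dist_triangle: "dist x z \<le> dist x y + dist y z"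
proof -
  have "(adj ^^ (dist x y + dist y z)) x z"
    unfolding relpowp_add using walk_of_length_dist by blast
  then show ?thesis by (rule dist_le_walk)
qed

lemma dist_self: "dist x x = 0"
  using dist_le_walk[of 0 x x] by simp

lemma dist_eq_0_iff: "dist x y = 0 \<longleftrightarrow> x = y"
  using walk_of_length_dist[of x y] dist_self by auto

lemma dist_eq_1_iff: "dist x y = Suc 0 \<longleftrightarrow> adj x y"
proof
  assume "dist x y = Suc 0"
  then show "adj x y" using walk_of_length_dist[of x y] by (simp add: eq_OO)
next
  assume a: "adj x y"
  then have "dist x y \<le> 1" using dist_le_walk[of 1 x y] by (simp add: eq_OO)
  moreover have "dist x y \<noteq> 0" using a adj_irrefl dist_eq_0_iff by auto
  ultimately show "dist x y = Suc 0" by simp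
qed

lemma gsphere_1: "gsphere adj 1 x = {y. adj x y}"
  by (simp add: gsphere_def dist_eq_1_iff)

lemma dist_le_diam: "dist x y \<le> diam adj"
proof -
  have "{dist x y | x y. True} = range (\<lambda>(x, y). dist x y)" by auto
  then have "finite {dist x y | x y. True}" by simp
  then show ?thesis unfolding diam_def by (rule Max_ge) auto
qed

lemma card_sphere_inter:
  assumes "dist x y = h" "i \<le> diam adj" "j \<le> diam adj"
  shows "card {z. dist x z = i \<and> dist y z = j} = inter_num adj h i j"
proof -
  have "h \<le> diam adj" using assms(1) dist_le_diam by blast
  then obtain p where p: "\<forall>x y. dist x y = h \<longrightarrow> card (gsphere adj i x \<inter> gsphere adj j y) = p"
    using regular assms(2,3) unfolding distance_regular_def by meson
  have "inter_num adj h i j = p" unfolding inter_num_def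
    using p assms(1) by (intro the_equality) auto
  moreover have "gsphere adj i x \<inter> gsphere adj j y = {z. dist x z = i \<and> dist y z = j}"
    by (auto simp: gsphere_def)
  ultimately show ?thesis using p assms(1) by metis
qed

end

section \<open>Two-homogeneous bipartite graphs\<close>

locale two_homogeneous_graph = distance_regular_graph adj + generic_q q
  for adj :: "'a::finite \<Rightarrow> 'a \<Rightarrow> bool" and q :: complex +
  fixes E :: "nat \<Rightarrow> complex^'a^'a" and D :: nat and H :: complex
  assumes D_eq: "D = diam adj" and D_ge_3: "D \<ge> 3"
    and two_hom: "two_homogeneous_bipartite adj"
    and idempotents: "primitive_idempotents adj E"
    and H_eq: "H = \<i> * (qc (int D - 2) / qs (- 2))"
    and dual_eigval_eq: "i \<le> D \<Longrightarrow> dual_eigval adj E i = H * \<i> * qs (int D - 2 * int i)"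
    and c_eq: "i \<le> D \<Longrightarrow> of_nat (c_num adj i) = H * \<i> * (qs (2 * int i) / qc (int D - 2 * int i))"
    and b_eq: "i \<le> D \<Longrightarrow> of_nat (b_num adj i)
                 = H * \<i> * (qs (2 * int D - 2 * int i) / qc (int D - 2 * int i))"
begin

definition K :: complex where "K = qc (int D - 2) / qs 2"

lemma H_i: "H * \<i> = K"
proof -
  have "H * \<i> = (\<i> * \<i>) * (qc (int D - 2) / qs (- 2))" unfolding H_eq by (simp only: ac_simps)
  then show ?thesis using qs_uminus[of 2] by (simp add: K_def)
qed

lemma K_nonzero: "K \<noteq> 0"
  by (simp add: K_def qs_eq_0_iff qc_nonzero)

definition theta :: "int \<Rightarrow> complex" where "theta n = K * qs (int D - 2 * n)"

lemma dist_le_D: "dist x y \<le> D"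
  using dist_le_diam D_eq by simp

lemma neighbour_dist_neq: "adj x w \<Longrightarrow> dist w y \<noteq> dist x y"
proof
  assume a: "adj x w" and e: "dist w y = dist x y"
  have "card {z. dist x z = 1 \<and> dist y z = dist x y} = a_num adj (dist x y)"
    unfolding a_num_def using D_ge_3 D_eq dist_le_diam by (intro card_sphere_inter) auto
  also have "\<dots> = 0" using two_hom dist_le_diam
    unfolding two_homogeneous_bipartite_def bipartite_drg_def by blast
  finally have "{z. dist x z = 1 \<and> dist y z = dist x y} = {}" by simp
  moreover have "dist x w = 1 \<and> dist y w = dist x y" using a e dist_sym[of y w] dist_eq_1_iff by simp
  ultimately show False by blast
qed

lemma neighbour_dist:
  assumes "adj x w"
  shows "int (dist w y) = int (dist x y) + 1 \<or> int (dist w y) = int (dist x y) - 1"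
proof -
  have "dist x w = 1" "dist w x = 1"
    using assms dist_eq_1_iff[of x w] dist_sym[of x w] by simp_all
  then show ?thesis
    using dist_triangle[of w y x] dist_triangle[of x y w] neighbour_dist_neq[OF assms, of y]
    by linarith
qed

lemma card_neighbours_closer:
  "of_nat (card {w. adj x w \<and> int (dist w y) = int (dist x y) - 1})
     = K * (qs (2 * int (dist x y)) / qc (int D - 2 * int (dist x y)))"
proof (cases "dist x y = 0")
  case True
  then show ?thesis by (simp add: qs_zero)
next
  case False
  have "card {w. dist x w = 1 \<and> dist y w = dist x y - 1} = c_num adj (dist x y)"
    unfolding c_num_def using False D_ge_3 D_eq dist_le_diam[of x y]
    by (auto intro!: card_sphere_inter)
  moreover have "{w. dist x w = 1 \<and> dist y w = dist x y - 1}
      = {w. adj x w \<and> int (dist w y) = int (dist x y) - 1}"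
    using False dist_sym[of y] by (auto simp: dist_eq_1_iff)
  ultimately show ?thesis using c_eq[OF dist_le_D, of x y] by (simp add: H_i)
qed

lemma card_neighbours_further:
  "of_nat (card {w. adj x w \<and> int (dist w y) = int (dist x y) + 1})
     = K * (qs (2 * int D - 2 * int (dist x y)) / qc (int D - 2 * int (dist x y)))"
proof (cases "dist x y = D")
  case True
  have "int (dist w y) \<noteq> int (dist x y) + 1" for w using dist_le_D[of w y] True by linarith
  then have "{w. adj x w \<and> int (dist w y) = int (dist x y) + 1} = {}" by simp
  with True show ?thesis by (simp add: qs_zero)
next
  case False
  then have lt: "dist x y < D" using dist_le_D le_neq_implies_less by blast
  have "card {w. dist x w = 1 \<and> dist y w = dist x y + 1} = b_num adj (dist x y)"
    unfolding b_num_def using lt D_ge_3 D_eq by (auto intro!: card_sphere_inter)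
  moreover have "{w. dist x w = 1 \<and> dist y w = dist x y + 1}
      = {w. adj x w \<and> int (dist w y) = int (dist x y) + 1}"
    using dist_sym[of y] by (auto simp: dist_eq_1_iff)
  ultimately show ?thesis using b_eq[OF dist_le_D, of x y] by (simp add: H_i)
qed

text \<open>As \<open>b\<^sub>i\<close> does not vanish for \<open>i < D\<close>, every geodesic extends until it has length \<open>D\<close>.\<close>

lemma further_neighbour_exists:
  assumes "dist x y < D"
  shows "\<exists>w. adj x w \<and> dist w y = dist x y + 1"
proof -
  have "{w. adj x w \<and> int (dist w y) = int (dist x y) + 1} \<noteq> {}"
  proof
    assume "{w. adj x w \<and> int (dist w y) = int (dist x y) + 1} = {}"
    then have "qs (2 * int D - 2 * int (dist x y)) = 0"
      using card_neighbours_further[of x y] K_nonzero qc_nonzero by (simp only: card.empty) simp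
    then show False using assms by (simp add: qs_eq_0_iff)
  qed
  then show ?thesis by auto
qed

lemma geodesic_extends:
  assumes "dist x y + n \<le> D"
  shows "\<exists>w. dist x w = n \<and> dist w y = dist x y + n"
  using assms
proof (induction n)
  case 0
  then show ?case using dist_self by auto
next
  case (Suc n)
  then obtain w where w: "dist x w = n" "dist w y = dist x y + n" by auto
  with Suc.prems obtain v where v: "adj w v" "dist v y = dist x y + Suc n"
    using further_neighbour_exists[of w y] by auto
  have "dist x v \<le> Suc n" using dist_triangle[of x v w] w v(1) by (simp flip: dist_eq_1_iff)
  moreover have "dist v y \<le> dist v x + dist x y" by (rule dist_triangle)
  ultimately have "dist x v = Suc n" using v(2) dist_sym[of v x] by simp
  with v(2) show ?case by auto
qed

lemma dist_realised: "i \<le> D \<Longrightarrow> \<exists>w. dist x w = i"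
  using geodesic_extends[of x x i] by (auto simp: dist_self)

lemma antipode_unique:
  assumes "dist x v = D" "dist x w = D"
  shows "v = w"
proof -
  have "card {z. dist x z = D \<and> dist x z = D} = k_num adj (diam adj)"
    unfolding k_num_def D_eq by (intro card_sphere_inter) (simp_all add: dist_self)
  then have "card {z. dist x z = D} = 1"
    using two_hom unfolding two_homogeneous_bipartite_def by simp
  then obtain a where "{z. dist x z = D} = {a}" by (rule card_1_singletonE)
  then have "v \<in> {a}" "w \<in> {a}" using assms by auto
  then show ?thesis by simp
qed

text \<open>Since \<open>x\<close> has a single antipode \<open>x'\<close>, every vertex lies on a geodesic from \<open>x\<close> to \<open>x'\<close>; the
  triangle inequality for \<open>y, z, x'\<close> is then the claimed bound.\<close>

lemma perimeter_le: "dist x y + dist y z + dist z x \<le> 2 * D"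
proof -
  have ex: "\<exists>v. dist v x = D \<and> dist y v = D - dist y x" for y
    using geodesic_extends[of y x "D - dist y x"] dist_le_D[of y x] by auto
  obtain v where v: "dist v x = D" "dist y v = D - dist y x" using ex by blast
  obtain v' where v': "dist v' x = D" "dist z v' = D - dist z x" using ex by blast
  have "v = v'" using antipode_unique[of x v v'] v v' dist_sym by metis
  then have "dist y z \<le> (D - dist y x) + (D - dist z x)"
    using dist_triangle[of y z v] v v' dist_sym by metis
  then show ?thesis using dist_sym[of x y] dist_le_D[of y x] dist_le_D[of z x] by linarith
qed

lemma perimeter_even: "even (dist x y + dist y z + dist z x)"
proof -
  have "even (dist x y + dist y z + n)" if "(adj ^^ n) x z" for n z
    using that
  proof (induction n arbitrary: z)
    case 0
    then show ?case using dist_sym[of x y] by simp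
  next
    case (Suc n)
    then obtain w where w: "(adj ^^ n) x w" "adj w z" by (auto elim: relpowp_Suc_E)
    show ?case using Suc.IH[OF w(1)] neighbour_dist[OF w(2), of y] dist_sym[of y w] dist_sym[of y z]
      by presburger
  qed
  from this[OF walk_of_length_dist] show ?thesis using dist_sym[of z x] by simp
qed

lemma profile_exists: "\<exists>p\<in>profiles D. has_profile adj x y z p"
proof -
  define i h j where "i = dist x y" and "h = dist y z" and "j = dist z x"
  have tri: "h \<le> i + j" "i \<le> h + j" "j \<le> i + h"
    using dist_triangle[of y z x] dist_triangle[of x y z] dist_triangle[of z x y]
      dist_sym[of x y] dist_sym[of y z] dist_sym[of z x] unfolding i_def h_def j_def by linarith+
  obtain n where n: "i + h + j = 2 * n"
    using perimeter_even[of x y z] unfolding i_def h_def j_def by (rule evenE)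
  have "n \<le> D" using perimeter_le[of x y z] n unfolding i_def h_def j_def by simp
  then have "has_profile adj x y z (D - n, n - h, n - j, n - i)"
    unfolding has_profile_def prod.case D_eq[symmetric] i_def[symmetric] h_def[symmetric] j_def[symmetric]
    using tri n by (intro conjI) linarith+
  moreover have "(D - n, n - h, n - j, n - i) \<in> profiles D"
    using \<open>n \<le> D\<close> tri n by (auto simp: profiles_def)
  ultimately show ?thesis by blast
qed

end

section \<open>The first primitive idempotent\<close>

lemma sum_of_bool_eq_UNIV: "(\<Sum>b\<in>UNIV. f b * of_bool (b = c)) = (f c :: complex)" for c :: "'b::finite"
  by (simp add: of_bool_def if_distrib cong: if_cong)

text \<open>As \<open>G\<close> is an orthogonal projection, \<open>\<parallel>G u\<parallel>\<^sup>2 = \<langle>u, G u\<rangle>\<close>, which vanishes if \<open>G u\<close> is zero on the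
  support of \<open>u\<close>.\<close>

lemma projection_kernel:
  fixes G :: "complex^'n^'n" and u :: "'n \<Rightarrow> complex"
  assumes idem: "G ** G = G" and herm: "\<And>a b. cnj (G $ a $ b) = G $ b $ a"
    and supp: "\<And>a. u a \<noteq> 0 \<Longrightarrow> (\<Sum>b\<in>UNIV. G $ a $ b * u b) = 0"
  shows "(\<Sum>b\<in>UNIV. G $ a $ b * u b) = 0"
proof -
  define h where "h = (\<lambda>a. \<Sum>b\<in>UNIV. G $ a $ b * u b)"
  have Gh: "(\<Sum>y\<in>UNIV. G $ a $ y * h y) = h a" for a
  proof -
    have "(\<Sum>y\<in>UNIV. G $ a $ y * h y) = (\<Sum>b\<in>UNIV. (\<Sum>y\<in>UNIV. G $ a $ y * G $ y $ b) * u b)"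
      unfolding h_def by (simp add: sum_distrib_left sum_distrib_right mult.assoc) (rule sum.swap)
    also have "\<dots> = (\<Sum>b\<in>UNIV. (G ** G) $ a $ b * u b)" by (simp add: matrix_matrix_mult_def)
    finally show ?thesis by (simp add: idem h_def)
  qed
  have "(\<Sum>y\<in>UNIV. cnj (h y) * h y) = (\<Sum>a\<in>UNIV. cnj (u a) * (\<Sum>y\<in>UNIV. G $ a $ y * h y))"
  proof -
    have H: "cnj (h y) = (\<Sum>b\<in>UNIV. cnj (G $ y $ b) * cnj (u b))" for y by (simp add: h_def)
    have "(\<Sum>y\<in>UNIV. cnj (h y) * h y) = (\<Sum>y\<in>UNIV. \<Sum>a\<in>UNIV. cnj (u a) * (G $ a $ y * h y))"
      by (simp add: H herm sum_distrib_right sum_distrib_left ac_simps)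
    also have "\<dots> = (\<Sum>a\<in>UNIV. \<Sum>y\<in>UNIV. cnj (u a) * (G $ a $ y * h y))" by (rule sum.swap)
    finally show ?thesis by (simp add: sum_distrib_left)
  qed
  also have "\<dots> = (\<Sum>a\<in>UNIV. cnj (u a) * h a)" by (simp add: Gh)
  also have "\<dots> = 0" using supp by (intro sum.neutral) (auto simp: h_def)
  finally have "(\<Sum>y\<in>UNIV. of_real ((cmod (h y))\<^sup>2)) = (0::complex)"
    by (simp add: complex_norm_square mult.commute del: of_real_power)
  then have "(\<Sum>y\<in>UNIV. (cmod (h y))\<^sup>2) = 0" by (metis of_real_eq_0_iff of_real_sum)
  then have "h a = 0" by (simp add: sum_nonneg_eq_0_iff)
  then show ?thesis by (simp add: h_def)
qed

context two_homogeneous_graph begin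

lemma span_dist_mat_entry:
  assumes "M \<in> smat.span (dist_mat adj ` {..D})"
  shows "\<exists>t. \<forall>x y. M $ y $ x = t (dist x y)"
  using assms
proof (induction rule: smat.span_induct_alt)
  case base
  then show ?case by (intro exI[of _ "\<lambda>_. 0"]) simp
next
  case (step c N M)
  then obtain i t where N: "N = dist_mat adj i" and t: "\<And>x y. M $ y $ x = t (dist x y)" by auto
  show ?case unfolding N
    by (intro exI[of _ "\<lambda>k. (if k = i then c else 0) + t k"])
      (auto simp: t smat_def dist_mat_def gsphere_def)
qed

lemma sum_dist_mat_entry:
  "(\<Sum>i\<le>D. smat (t i) (dist_mat adj i)) $ y $ x = t (dist x y)"
proof -
  have "(\<Sum>i\<le>D. smat (t i) (dist_mat adj i)) $ y $ x = (\<Sum>i\<le>D. if i = dist x y then t i else 0)"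
    unfolding sum_component by (intro sum.cong) (auto simp: smat_def dist_mat_def gsphere_def)
  then show ?thesis using dist_le_D by simp
qed

lemma E1_in_span: "E 1 \<in> smat.span (dist_mat adj ` {..D})"
  using idempotents D_ge_3 D_eq smat.span_base[of "E 1" "E ` {..D}"]
  unfolding primitive_idempotents_def bose_mesner_def by auto

text \<open>The dual eigenvalues are determined by \<open>E\<^sub>1\<close>, because every \<open>i \<le> D\<close> occurs as a distance.\<close>

lemma E1_entry: "E 1 $ y $ x = theta (int (dist x y)) / of_nat CARD('a)"
proof -
  obtain e where e: "E 1 $ y $ x = e (dist x y)" for x y
    using span_dist_mat_entry[OF E1_in_span] by blast
  define t where "t = (\<lambda>i. if i > D then 0 else of_nat CARD('a) * e i)"
  have t: "(\<forall>i>D. t i = 0) \<and>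
      E 1 = smat (1 / of_nat CARD('a)) (\<Sum>i\<le>D. smat (t i) (dist_mat adj i))"
    unfolding vec_eq_iff smat_def[of "1 / _"] vec_lambda_beta sum_dist_mat_entry
    using dist_le_D by (simp add: t_def e[simplified] flip: not_le)
  have "dual_eigval adj E = t" unfolding dual_eigval_def D_eq[symmetric]
  proof (rule the_equality)
    show "(\<forall>i>D. t i = 0) \<and> E 1 = smat (1 / of_nat CARD('a)) (\<Sum>i\<le>D. smat (t i) (dist_mat adj i))"
      by (rule t)
  next
    fix s
    assume s: "(\<forall>i>D. s i = 0) \<and>
      E 1 = smat (1 / of_nat CARD('a)) (\<Sum>i\<le>D. smat (s i) (dist_mat adj i))"
    have "s i = t i" if i: "i \<le> D" for i
    proof -
      obtain w where w: "dist undefined w = i" using dist_realised[OF i] by blast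
      have "smat (1 / of_nat CARD('a)) (\<Sum>i\<le>D. smat (s i) (dist_mat adj i)) $ w $ undefined
          = smat (1 / of_nat CARD('a)) (\<Sum>i\<le>D. smat (t i) (dist_mat adj i)) $ w $ undefined"
        using s t by metis
      then show ?thesis
        unfolding smat_def[of "1 / _"] vec_lambda_beta sum_dist_mat_entry w by simp
    qed
    then show "s = t" using s t by (auto simp: fun_eq_iff) (metis not_le)
  qed
  then have "t (dist x y) = theta (int (dist x y))"
    using dual_eigval_eq[OF dist_le_D, of x y] by (simp add: theta_def H_i)
  then show ?thesis using dist_le_D[of x y] by (simp add: t_def e[simplified] field_simps flip: not_le)
qed

lemma E1_symmetric: "E 1 $ y $ x = E 1 $ x $ y"
  by (simp only: E1_entry dist_sym)

lemma idempotent_mult: "i \<le> D \<Longrightarrow> j \<le> D \<Longrightarrow> E i ** E j = (if i = j then E i else 0)"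
  using idempotents unfolding primitive_idempotents_def D_eq by blast

lemma E1_idem: "E 1 ** E 1 = E 1"
  using idempotent_mult[of 1 1] D_ge_3 by simp

lemma E1_nonzero: "E 1 \<noteq> 0"
  using idempotents D_ge_3 smat.dependent_zero[of "E ` {..diam adj}"]
  unfolding primitive_idempotents_def D_eq by (metis One_nat_def Suc_leI atMost_iff gr0I image_eqI not_numeral_le_zero)

lemma smat_mult_left: "smat c M ** N = smat c (M ** N)"
  and smat_mult_right: "M ** smat c N = smat c (M ** N)"
  for M N :: "complex^'n^'n"
  by (simp_all add: smat_def matrix_matrix_mult_def vec_eq_iff sum_distrib_left ac_simps)

lemma matrix_distrib_right: "(M + N) ** L = M ** L + N ** L" for M N L :: "complex^'n^'n"
  by (simp add: matrix_matrix_mult_def vec_eq_iff sum.distrib algebra_simps)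

text \<open>The entrywise conjugate \<open>F\<close> of \<open>E\<^sub>1\<close> lies in the Bose-Mesner algebra, so \<open>E\<^sub>1 F = a E\<^sub>1\<close> for
  some \<open>a\<close>, which is nonzero because the diagonal entries of \<open>E\<^sub>1 F\<close> are the squared norms of
  the rows of \<open>E\<^sub>1\<close>. As \<open>F E\<^sub>1 = a E\<^sub>1\<close> too, conjugation gives
  \<open>a E\<^sub>1 = cnj a F\<close>, so \<open>F\<close> is a multiple of \<open>E\<^sub>1\<close>; since both
  are idempotent, they agree.\<close>

lemma E1_real: "cnj (E 1 $ y $ x) = E 1 $ y $ x"
proof -
  define F where "F = (\<chi> y x. cnj (E 1 $ y $ x))"
  have cnj_mult: "(\<chi> y x. cnj ((M ** N) $ y $ x)) = (\<chi> y x. cnj (M $ y $ x)) ** (\<chi> y x. cnj (N $ y $ x))"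
    for M N :: "complex^'a^'a"
    by (simp add: matrix_matrix_mult_def vec_eq_iff)
  have F_cnj: "(\<chi> y x. cnj (F $ y $ x)) = E 1" by (simp add: F_def vec_eq_iff)
  have F_idem: "F ** F = F" using cnj_mult[of "E 1" "E 1"] unfolding E1_idem F_def[symmetric] by (rule sym)
  have "F = (\<Sum>i\<le>D. smat (cnj (theta (int i)) / of_nat CARD('a)) (dist_mat adj i))"
    unfolding vec_eq_iff sum_dist_mat_entry by (simp add: F_def E1_entry del: One_nat_def)
  then have "F \<in> smat.span (E ` {..D})"
    using idempotents unfolding primitive_idempotents_def bose_mesner_def D_eq
    by (auto intro!: smat.span_sum smat.span_scale intro: smat.span_base)
  then have "\<exists>a. E 1 ** F = smat a (E 1) \<and> F ** E 1 = smat a (E 1)"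
  proof (induction rule: smat.span_induct_alt)
    case base
    then show ?case by (intro exI[of _ 0]) (simp add: smat_def vec_eq_iff matrix_matrix_mult_def)
  next
    case (step c N M)
    then obtain i a where N: "N = E i" "i \<le> D" and a: "E 1 ** M = smat a (E 1)" "M ** E 1 = smat a (E 1)" by auto
    show ?case unfolding N
      by (intro exI[of _ "(if i = 1 then c else 0) + a"])
        (use N(2) D_ge_3 in \<open>auto simp: matrix_add_ldistrib matrix_distrib_right smat_mult_left smat_mult_right a[simplified]
            idempotent_mult smat.scale_left_distrib\<close>)
  qed
  then obtain a where a: "E 1 ** F = smat a (E 1)" "F ** E 1 = smat a (E 1)" by blast
  have "smat (cnj a) F = (\<chi> y x. cnj ((smat a (E 1)) $ y $ x))" by (simp add: smat_def F_def vec_eq_iff)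
  also have "\<dots> = F ** E 1" using cnj_mult[of "E 1" F] unfolding a(1) F_cnj by (simp add: F_def)
  finally have aF: "smat (cnj a) F = smat a (E 1)" unfolding a(2) .
  have "a \<noteq> 0"
  proof
    assume "a = 0"
    then have 0: "(E 1 ** F) $ x $ x = 0" for x unfolding a(1) by (simp add: smat_def)
    have "E 1 $ x $ y = 0" for x y
    proof -
      have "(E 1 ** F) $ x $ x = (\<Sum>y\<in>UNIV. of_real ((cmod (E 1 $ x $ y))\<^sup>2))"
        using E1_symmetric[of _ x]
        by (simp add: matrix_matrix_mult_def F_def complex_norm_square del: of_real_power)
      with 0 have "(\<Sum>y\<in>UNIV. (cmod (E 1 $ x $ y))\<^sup>2) = 0" by (metis of_real_eq_0_iff of_real_sum)
      then show ?thesis by (simp add: sum_nonneg_eq_0_iff)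
    qed
    then show False using E1_nonzero by (simp add: vec_eq_iff)
  qed
  define b where "b = cnj a / a"
  have E1: "E 1 = smat b F"
    using aF \<open>a \<noteq> 0\<close> by (simp add: smat_def vec_eq_iff b_def field_simps)
  have "smat b (E 1) = smat b (smat b (F ** F))" by (simp only: E1 F_idem)
  also have "\<dots> = E 1 ** E 1" by (simp only: E1 smat_mult_left smat_mult_right)
  finally have "smat b (E 1) = smat 1 (E 1)" unfolding E1_idem by simp
  then have "b = 1" using E1_nonzero smat.scale_cancel_right by blast
  then have "E 1 = F" using E1 by simp
  then show ?thesis by (simp add: F_def vec_eq_iff)
qed

section \<open>Counting the neighbours of a vertex by their distances to two others\<close>

text \<open>The coefficients are the solution of the two linear equations that make \<open>\<Phi>\<close>, a multiple of \<open>E\<^sub>1 u\<close>, vanish at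
  \<open>x\<close> and \<open>z\<close>. Distinct elements of \<open>S\<close> have distance 2, and it turns out that \<open>\<Phi>\<close> vanishes on \<open>S\<close> as well.
  So it vanishes on the support of \<open>u\<close>, hence everywhere.\<close>

lemma balanced_neighbours:
  fixes x y z :: 'a
  defines "j \<equiv> int (dist x z)"
  shows "(\<Sum>w | adj x w \<and> int (dist w z) = j - 1. theta (int (dist w y)))
    = K * qs (2 * j - 2) / qc (int D - 2 * j) * theta (int (dist x y))
      + K * qs 2 / qc (int D - 2 * j) * theta (int (dist z y))"
proof -
  define S where "S = {w. adj x w \<and> int (dist w z) = j - 1}"
  define \<alpha> \<beta> where "\<alpha> = K * qs (2 * j - 2) / qc (int D - 2 * j)"
    and "\<beta> = K * qs 2 / qc (int D - 2 * j)"
  define \<Phi> where "\<Phi> = (\<lambda>a. (\<Sum>w\<in>S. theta (int (dist w a)))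
      - \<alpha> * theta (int (dist x a)) - \<beta> * theta (int (dist z a)))"
  define u :: "'a \<Rightarrow> complex" where "u = (\<lambda>b. of_bool (b \<in> S) - \<alpha> * of_bool (b = x) - \<beta> * of_bool (b = z))"
  have sum_u: "(\<Sum>b\<in>UNIV. E 1 $ a $ b * u b) = \<Phi> a / of_nat CARD('a)" for a
  proof -
    have "(\<Sum>b\<in>UNIV. E 1 $ a $ b * u b) = (\<Sum>b\<in>UNIV. E 1 $ a $ b * of_bool (b \<in> S))
       - \<alpha> * (\<Sum>b\<in>UNIV. E 1 $ a $ b * of_bool (b = x)) - \<beta> * (\<Sum>b\<in>UNIV. E 1 $ a $ b * of_bool (b = z))"
      by (simp only: u_def right_diff_distrib sum_subtractf sum_distrib_left mult.left_commute)
    also have "(\<Sum>b\<in>UNIV. E 1 $ a $ b * of_bool (b \<in> S)) = (\<Sum>b\<in>S. E 1 $ a $ b)"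
      by (rule sum.mono_neutral_cong_right) auto
    finally show ?thesis
      unfolding sum_of_bool_eq_UNIV E1_entry by (simp add: \<Phi>_def diff_divide_distrib sum_divide_distrib)
  qed
  have "\<Phi> a = 0" if "a \<in> S \<or> a = x \<or> a = z" for a
  proof (cases "j = 0")
    case True
    then have "x = z" "S = {}" by (auto simp: j_def S_def dist_eq_0_iff dist_self)
    then show ?thesis using True qs_uminus[of 2] by (simp add: \<Phi>_def \<alpha>_def \<beta>_def)
  next
    case False
    have card_S: "of_nat (card S) = K * qs (2 * j) / qc (int D - 2 * j)"
      using card_neighbours_closer[of x z] by (simp add: S_def j_def)
    have dist_S: "int (dist w x) = 1" "int (dist w z) = j - 1" "adj x w" if "w \<in> S" for w
      using that dist_eq_1_iff[of x w] dist_sym[of x w] by (auto simp: S_def)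
    have dist_SS: "int (dist w a) = 2" if "a \<in> S" "w \<in> S" "w \<noteq> a" for w a
    proof -
      have "int (dist w a) = int (dist x a) + 1 \<or> int (dist w a) = int (dist x a) - 1"
        using neighbour_dist[OF dist_S(3)[OF that(2)]] .
      moreover have "dist w a \<noteq> 0" using that(3) by (simp add: dist_eq_0_iff)
      ultimately show ?thesis using dist_S(1)[OF that(1)] dist_sym[of x a] by auto
    qed
    consider "a = x" | "a = z" | "a \<in> S" using \<open>a \<in> S \<or> a = x \<or> a = z\<close> by blast
    then show ?thesis
    proof cases
      case 1
      have "\<Phi> x = of_nat (card S) * theta 1 - \<alpha> * theta 0 - \<beta> * theta j"
        using dist_sym[of z x] by (simp add: \<Phi>_def dist_S dist_self j_def)
      also have "\<dots> = K * K / qc (int D - 2 * j) * (qs (2 * j) * qs (int D - 2)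
          - qs (2 * j - 2) * qs (int D) - qs 2 * qs (int D - 2 * j))"
        unfolding card_S \<alpha>_def \<beta>_def theta_def by (simp add: field_simps qc_nonzero)
      also have "\<dots> = 0" unfolding qs_mult_qs using qc_uminus[of "int D - 2 * j + 2"] qc_uminus[of "int D - 2 * j - 2"] by (simp add: algebra_simps)
      finally show ?thesis using 1 by simp
    next
      case 2
      have "\<Phi> z = of_nat (card S) * theta (j - 1) - \<alpha> * theta j - \<beta> * theta 0"
        by (simp add: \<Phi>_def dist_S dist_self j_def)
      also have "\<dots> = K * K / qc (int D - 2 * j) * (qs (2 * j) * qs (int D - 2 * j + 2)
          - qs (2 * j - 2) * qs (int D - 2 * j) - qs 2 * qs (int D))"
        unfolding card_S \<alpha>_def \<beta>_def theta_def by (simp add: field_simps qc_nonzero)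
      also have "\<dots> = 0" unfolding qs_mult_qs using qc_uminus[of "int D - 2 * j + 2"] qc_uminus[of "int D - 2"] by (simp add: algebra_simps)
      finally show ?thesis using 2 by simp
    next
      case 3
      have "(\<Sum>w\<in>S. theta (int (dist w a))) = theta 0 + (\<Sum>w\<in>S - {a}. theta (int (dist w a)))"
        using 3 by (subst sum.remove[of _ a]) (simp_all add: dist_self)
      also have "(\<Sum>w\<in>S - {a}. theta (int (dist w a))) = (\<Sum>w\<in>S - {a}. theta 2)"
        using dist_SS 3 by (intro sum.cong) auto
      also have "\<dots> = (of_nat (card S) - 1) * theta 2"
        using 3 card_Suc_Diff1[of S a] by (simp flip: of_nat_Suc)
      finally have "\<Phi> a = theta 0 + (of_nat (card S) - 1) * theta 2 - \<alpha> * theta 1 - \<beta> * theta (j - 1)"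
        using dist_S[OF 3] dist_sym[of x a] dist_sym[of z a] by (simp add: \<Phi>_def)
      also have "\<dots> = K * (qs (int D) - qs (int D - 4)) + K * K / qc (int D - 2 * j) *
          (qs (2 * j) * qs (int D - 4) - qs (2 * j - 2) * qs (int D - 2) - qs 2 * qs (int D - 2 * j + 2))"
        unfolding card_S \<alpha>_def \<beta>_def theta_def by (simp add: field_simps qc_nonzero)
      \<comment> \<open>this is where the value \<open>{D-2}/[2]\<close> of \<open>K\<close> matters: \<open>[D] - [D-4] = [2]{D-2}\<close>\<close>
      also have "qs (int D) - qs (int D - 4) = K * qs 2 * qs 2"
        using qs_mult_qc[of 2 "int D - 2"] qs_uminus[of "int D - 4"] by (simp add: K_def qs_eq_0_iff algebra_simps)
      also have "K * (K * qs 2 * qs 2) = K * K / qc (int D - 2 * j) * (qc (int D - 2 * j) * (qs 2 * qs 2))"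
        by (simp add: qc_nonzero)
      also have "\<dots> + K * K / qc (int D - 2 * j) *
          (qs (2 * j) * qs (int D - 4) - qs (2 * j - 2) * qs (int D - 2) - qs 2 * qs (int D - 2 * j + 2))
        = K * K / qc (int D - 2 * j) * (qc (int D - 2 * j) * (qs 2 * qs 2) +
          (qs (2 * j) * qs (int D - 4) - qs (2 * j - 2) * qs (int D - 2) - qs 2 * qs (int D - 2 * j + 2)))"
        by (simp only: distrib_left)
      also have "\<dots> = 0" unfolding qs_mult_qs right_diff_distrib qc_mult_qc
        using qc_uminus[of "int D - 2 * j - 4"] qc_uminus[of "int D - 2 * j"]
        by (simp add: algebra_simps)
      finally show ?thesis using 3 by simp
    qed
  qed
  then have supp: "(\<Sum>b\<in>UNIV. E 1 $ a $ b * u b) = 0" if "u a \<noteq> 0" for a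
  proof -
    have "a \<in> S \<or> a = x \<or> a = z" by (rule ccontr) (use that in \<open>simp add: u_def\<close>)
    then show ?thesis unfolding sum_u using \<open>\<And>a. a \<in> S \<or> a = x \<or> a = z \<Longrightarrow> \<Phi> a = 0\<close> by simp
  qed
  have "cnj (E 1 $ a $ b) = E 1 $ b $ a" for a b
    unfolding E1_real by (rule E1_symmetric)
  from projection_kernel[OF E1_idem this supp, of y]
  have "\<Phi> y / of_nat CARD('a) = 0" unfolding sum_u .
  then have "(\<Sum>w\<in>S. theta (int (dist w y))) = \<alpha> * theta (int (dist x y)) + \<beta> * theta (int (dist z y))"
    by (simp add: \<Phi>_def diff_eq_eq add.commute)
  then show ?thesis unfolding \<alpha>_def \<beta>_def S_def .
qed

definition neighbour_count :: "'a \<Rightarrow> 'a \<Rightarrow> 'a \<Rightarrow> int \<Rightarrow> int \<Rightarrow> complex" where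
  "neighbour_count x y z \<epsilon> \<delta> = of_nat (card {w. adj x w \<and>
     int (dist w y) = int (dist x y) + \<epsilon> \<and> int (dist w z) = int (dist x z) + \<delta>})"

lemma sum_neighbours:
  "(\<Sum>w | adj x w. f (int (dist w y)) (int (dist w z)))
   = (\<Sum>\<epsilon>\<in>{1, -1}. \<Sum>\<delta>\<in>{1, -1}. neighbour_count x y z \<epsilon> \<delta> *
        (f (int (dist x y) + \<epsilon>) (int (dist x z) + \<delta>) :: complex))"
proof -
  let ?P = "\<lambda>w \<epsilon> \<delta>. int (dist w y) = int (dist x y) + \<epsilon> \<and> int (dist w z) = int (dist x z) + \<delta>"
  let ?f = "\<lambda>\<epsilon> \<delta>. f (int (dist x y) + \<epsilon>) (int (dist x z) + \<delta>)"
  have "(\<Sum>w | adj x w. f (int (dist w y)) (int (dist w z)))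
    = (\<Sum>w | adj x w. \<Sum>\<epsilon>\<in>{1, -1}. \<Sum>\<delta>\<in>{1, -1}. of_bool (?P w \<epsilon> \<delta>) * ?f \<epsilon> \<delta>)"
  proof (rule sum.cong[OF refl])
    have expand: "f a b = (\<Sum>\<epsilon>\<in>{1, -1}. \<Sum>\<delta>\<in>{1, -1}. of_bool (a = i + \<epsilon> \<and> b = j + \<delta>) * f (i + \<epsilon>) (j + \<delta>))"
      if "a = i + 1 \<or> a = i - 1" "b = j + 1 \<or> b = j - 1" for a b i j :: int
      unfolding sum_signs using that by (elim disjE; hypsubst) simp_all
    fix w assume "w \<in> {w. adj x w}"
    then have "adj x w" by simp
    then show "f (int (dist w y)) (int (dist w z))
        = (\<Sum>\<epsilon>\<in>{1, -1}. \<Sum>\<delta>\<in>{1, -1}. of_bool (?P w \<epsilon> \<delta>) * ?f \<epsilon> \<delta>)"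
      by (intro expand neighbour_dist)
  qed
  also have "\<dots> = (\<Sum>\<epsilon>\<in>{1, -1}. \<Sum>w | adj x w. \<Sum>\<delta>\<in>{1, -1}. of_bool (?P w \<epsilon> \<delta>) * ?f \<epsilon> \<delta>)"
    by (rule sum.swap)
  also have "\<dots> = (\<Sum>\<epsilon>\<in>{1, -1}. \<Sum>\<delta>\<in>{1, -1}. \<Sum>w | adj x w. of_bool (?P w \<epsilon> \<delta>) * ?f \<epsilon> \<delta>)"
    by (rule sum.cong[OF refl], rule sum.swap)
  also have "\<dots> = (\<Sum>\<epsilon>\<in>{1, -1}. \<Sum>\<delta>\<in>{1, -1}. neighbour_count x y z \<epsilon> \<delta> * ?f \<epsilon> \<delta>)"
    by (intro sum.cong refl) (simp add: neighbour_count_def Collect_conj_eq flip: sum_distrib_right)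
  finally show ?thesis .
qed

text \<open>The numbers of neighbours closer to \<open>y\<close>, closer to \<open>z\<close> and further from \<open>y\<close> are intersection numbers.
  Together with \<open>balanced_neighbours\<close> they determine the four counts; the difference
  \<open>[I+2] - [I-2] = [2]{I}\<close> is the determinant of the system.\<close>

lemma neighbour_count_eq:
  assumes "\<epsilon> \<in> {1, -1}" "\<delta> \<in> {1, -1}"
  shows "neighbour_count x y z \<epsilon> \<delta> = K * move_coeff (int D) \<epsilon> \<delta> (int D - 2 * int (dist x y))
    (int D - 2 * int (dist x z)) (int D - 2 * int (dist y z))"
proof -
  define i j h where "i = int (dist x y)" "j = int (dist x z)" "h = int (dist y z)"
  define I J L where "I = int D - 2 * i" "J = int D - 2 * j" "L = int D - 2 * h"
  define N where "N = neighbour_count x y z"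
  have closer_y: "N (-1) (-1) + N (-1) 1 = K * (qs (int D - I) / qc I)"
    using card_neighbours_closer[of x y] sum_neighbours[where x = x and y = y and z = z and f = "\<lambda>a b. of_bool (a = i - 1)"]
    by (simp add: i_j_h_def I_J_L_def N_def Collect_conj_eq add.commute)
  have closer_z: "N (-1) (-1) + N 1 (-1) = K * (qs (int D - J) / qc J)"
    using card_neighbours_closer[of x z] sum_neighbours[where x = x and y = y and z = z and f = "\<lambda>a b. of_bool (b = j - 1)"]
    by (simp add: i_j_h_def I_J_L_def N_def Collect_conj_eq add.commute)
  have further_y: "N 1 (-1) + N 1 1 = K * (qs (int D + I) / qc I)"
    using card_neighbours_further[of x y] sum_neighbours[where x = x and y = y and z = z and f = "\<lambda>a b. of_bool (a = i + 1)"]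
    by (simp add: i_j_h_def I_J_L_def N_def Collect_conj_eq add.commute)
  have balanced: "N (-1) (-1) * theta (i - 1) + N 1 (-1) * theta (i + 1) =
      K * qs (int D - J - 2) / qc J * theta i + K * qs 2 / qc J * theta h"
  proof -
    have "(\<Sum>w | adj x w. theta (int (dist w y)) * of_bool (int (dist w z) = j - 1))
      = (\<Sum>w | adj x w \<and> int (dist w z) = j - 1. theta (int (dist w y)))"
      by (rule sum.mono_neutral_cong_right) auto
    then show ?thesis
      using balanced_neighbours[where x = x and y = y and z = z] dist_sym[of y z]
        sum_neighbours[where x = x and y = y and z = z and f = "\<lambda>a b. theta a * of_bool (b = j - 1)"]
      by (simp add: i_j_h_def I_J_L_def N_def add.commute)
  qed
  have th: "theta (i - 1) = K * qs (I + 2)" "theta (i + 1) = K * qs (I - 2)" "theta i = K * qs I" "theta h = K * qs L"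
    by (simp_all add: theta_def I_J_L_def algebra_simps)
  have mm: "N (-1) (-1) = K * ((qs (int D - I - J) + qs L) / (qc I * qc J))"
  proof -
    have "N (-1) (-1) * (qs (I + 2) - qs (I - 2)) = N (-1) (-1) * qs (I + 2) + N 1 (-1) * qs (I - 2)
        - (N (-1) (-1) + N 1 (-1)) * qs (I - 2)" by (simp add: algebra_simps)
    also have "N (-1) (-1) * qs (I + 2) + N 1 (-1) * qs (I - 2) = K * qs (int D - J - 2) / qc J * qs I + K * qs 2 / qc J * qs L"
    proof -
      have "K * (N (-1) (-1) * qs (I + 2) + N 1 (-1) * qs (I - 2)) = K * (K * qs (int D - J - 2) / qc J * qs I + K * qs 2 / qc J * qs L)"
        using balanced unfolding th by (simp add: algebra_simps)
      then show ?thesis using K_nonzero by simp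
    qed
    also have "\<dots> - (N (-1) (-1) + N 1 (-1)) * qs (I - 2)
        = K / qc J * (qs (int D - J - 2) * qs I - qs (int D - J) * qs (I - 2) + qs 2 * qs L)"
      unfolding closer_z by (simp add: field_simps qc_nonzero)
    also have "qs (int D - J - 2) * qs I - qs (int D - J) * qs (I - 2) = qs 2 * qs (int D - I - J)"
      unfolding qs_mult_qs using qc_uminus[of "2 - (int D - I - J)"] by (simp add: algebra_simps)
    also have "qs (I + 2) - qs (I - 2) = qs 2 * qc I"
      using qs_mult_qc[of 2 I] qs_uminus[of "I - 2"] by (simp add: algebra_simps)
    finally have "qs 2 * (N (-1) (-1) * (qc I * qc J)) = qs 2 * (K * (qs (int D - I - J) + qs L))"
      by (simp add: field_simps qc_nonzero)
    then have "N (-1) (-1) * (qc I * qc J) = K * (qs (int D - I - J) + qs L)"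
      using qs_eq_0_iff[of 2] by simp
    then show ?thesis by (simp add: eq_divide_eq qc_nonzero)
  qed
  have mp: "N (-1) 1 = K * ((qs (int D - I + J) - qs L) / (qc I * qc J))"
  proof -
    have "N (-1) 1 = K * (qs (int D - I) / qc I) - N (-1) (-1)"
      unfolding closer_y[symmetric] by simp
    also have "\<dots> = K / (qc I * qc J) * (qs (int D - I) * qc J - qs (int D - I - J) - qs L)"
      unfolding mm by (simp add: field_simps qc_nonzero)
    finally have "N (-1) 1 = K / (qc I * qc J) * (qs (int D - I) * qc J - qs (int D - I - J) - qs L)" .
    then show ?thesis unfolding qs_mult_qc by (simp add: algebra_simps diff_divide_distrib add_divide_distrib)
  qed
  have pm: "N 1 (-1) = K * ((qs (int D + I - J) - qs L) / (qc I * qc J))"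
  proof -
    have "N 1 (-1) = K * (qs (int D - J) / qc J) - N (-1) (-1)"
      unfolding closer_z[symmetric] by simp
    also have "\<dots> = K / (qc I * qc J) * (qs (int D - J) * qc I - qs (int D - I - J) - qs L)"
      unfolding mm by (simp add: field_simps qc_nonzero)
    finally have "N 1 (-1) = K / (qc I * qc J) * (qs (int D - J) * qc I - qs (int D - I - J) - qs L)" .
    then show ?thesis unfolding qs_mult_qc by (simp add: algebra_simps diff_divide_distrib add_divide_distrib)
  qed
  have pp: "N 1 1 = K * ((qs (int D + I + J) + qs L) / (qc I * qc J))"
  proof -
    have "N 1 1 = K * (qs (int D + I) / qc I) - N 1 (-1)"
      unfolding further_y[symmetric] by simp
    also have "\<dots> = K / (qc I * qc J) * (qs (int D + I) * qc J - qs (int D + I - J) + qs L)"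
      unfolding pm by (simp add: field_simps qc_nonzero)
    finally have "N 1 1 = K / (qc I * qc J) * (qs (int D + I) * qc J - qs (int D + I - J) + qs L)" .
    then show ?thesis unfolding qs_mult_qc by (simp add: algebra_simps diff_divide_distrib add_divide_distrib)
  qed
  have "N \<epsilon> \<delta> = K * move_coeff (int D) \<epsilon> \<delta> I J L"
    using assms mm mp pm pp by (auto simp: move_coeff_def)
  then show ?thesis unfolding N_def I_J_L_def i_j_h_def .
qed
end

section \<open>The six maps\<close>

lemma tens_component: "tens x y z $ (x', y', z') = of_bool (x = x') * of_bool (y = y') * of_bool (z = z')"
  by (auto simp: tens_def axis_def)

lemma lin_ext_component:
  "lin_ext f v $ p = (\<Sum>x\<in>UNIV. \<Sum>y\<in>UNIV. \<Sum>z\<in>UNIV. v $ (x, y, z) * f x y z $ p)"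
  by (simp add: lin_ext_def sum_component)

context distance_regular_graph begin

lemma sum_neighbour_of_bool:
  "(\<Sum>\<xi>\<in>gsphere adj 1 a. of_bool (\<xi> = b)) = (of_bool (adj b a) :: complex)"
  unfolding gsphere_1 by (simp add: adj_sym[of b a] of_bool_def)

lemma A_1_component: "A_1 adj v $ (x, y, z) = (\<Sum>w | adj x w. v $ (w, y, z))"
proof -
  have "A_1 adj v $ (x, y, z) = (\<Sum>x'\<in>UNIV. \<Sum>y'\<in>UNIV. \<Sum>z'\<in>UNIV.
      v $ (x', y', z') * of_bool (adj x x') * of_bool (y' = y) * of_bool (z' = z))"
    unfolding A_1_def lin_ext_component
    by (simp only: sum_component tens_component sum_neighbour_of_bool mult.assoc flip: sum_distrib_right)
  then show ?thesis by (simp only: sum_of_bool_eq_UNIV) simp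
qed

lemma A_2_component: "A_2 adj v $ (x, y, z) = (\<Sum>w | adj y w. v $ (x, w, z))"
proof -
  have "A_2 adj v $ (x, y, z) = (\<Sum>x'\<in>UNIV. \<Sum>y'\<in>UNIV. \<Sum>z'\<in>UNIV.
      v $ (x', y', z') * of_bool (adj y y') * of_bool (x' = x) * of_bool (z' = z))"
    unfolding A_2_def lin_ext_component
    by (simp only: sum_component tens_component sum_neighbour_of_bool ac_simps flip: sum_distrib_right sum_distrib_left)
  then show ?thesis by (simp only: sum_of_bool_eq_UNIV sum_distrib_right[symmetric]) simp
qed

lemma A_3_component: "A_3 adj v $ (x, y, z) = (\<Sum>w | adj z w. v $ (x, y, w))"
proof -
  have "A_3 adj v $ (x, y, z) = (\<Sum>x'\<in>UNIV. \<Sum>y'\<in>UNIV. \<Sum>z'\<in>UNIV.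
      v $ (x', y', z') * of_bool (adj z z') * of_bool (y' = y) * of_bool (x' = x))"
    unfolding A_3_def lin_ext_component
    by (simp only: sum_component tens_component sum_neighbour_of_bool ac_simps flip: sum_distrib_right sum_distrib_left)
  then show ?thesis by (simp only: sum_of_bool_eq_UNIV sum_distrib_right[symmetric]) simp
qed

lemma diagonal_component:
  "lin_ext (\<lambda>x y z. f x y z *s tens x y z) v $ (x, y, z) = f x y z * v $ (x, y, z)"
  by (simp only: lin_ext_component vector_smult_component tens_component mult.assoc[symmetric]
      sum_of_bool_eq_UNIV sum_distrib_right[symmetric]) simp

end

context two_homogeneous_graph begin

lemma dual_eigval_theta: "dual_eigval adj E (dist x y) = theta (int (dist x y))"
  using dual_eigval_eq[OF dist_le_D] by (simp add: theta_def H_i)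

lemma Astar_1_component: "Astar_1 adj E v $ (x, y, z) = theta (int (dist y z)) * v $ (x, y, z)"
  and Astar_2_component: "Astar_2 adj E v $ (x, y, z) = theta (int (dist z x)) * v $ (x, y, z)"
  and Astar_3_component: "Astar_3 adj E v $ (x, y, z) = theta (int (dist x y)) * v $ (x, y, z)"
  unfolding Astar_1_def Astar_2_def Astar_3_def diagonal_component dual_eigval_theta by (rule refl)+

section \<open>The space \<open>\<Lambda>\<close> as a space of functions of three distances\<close>

definition triple_class :: "complex^('a \<times> 'a \<times> 'a) \<Rightarrow> grid_fun \<Rightarrow> bool" where
  "triple_class v g \<longleftrightarrow>
     (\<forall>x y z. v $ (x, y, z) = g (int (dist x y)) (int (dist y z)) (int (dist z x)))"

lemma profile_vec_component: "profile_vec adj p $ (x, y, z) = of_bool (has_profile adj x y z p)"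
proof -
  have "profile_vec adj p $ (x, y, z)
      = (\<Sum>t\<in>{(x, y, z). has_profile adj x y z p}. of_bool (t = (x, y, z)))"
    unfolding profile_vec_def sum_component
    by (intro sum.cong refl) (auto simp: tens_component)
  also have "\<dots> = of_bool (has_profile adj x y z p)" by (simp add: of_bool_def)
  finally show ?thesis .
qed

lemma has_profile_unique: "has_profile adj x y z p \<Longrightarrow> has_profile adj x y z p' \<Longrightarrow> p = p'"
  by (cases p; cases p') (auto simp: has_profile_def)

lemma finite_profiles: "finite (profiles n)"
proof (rule finite_subset)
  show "profiles n \<subseteq> {..n} \<times> {..n} \<times> {..n} \<times> {..n}" by (auto simp: profiles_def)
qed simp

text \<open>The distances of a triple determine its profile and conversely, so the vectors that depend only on
  the distances are the combinations of the profile vectors. A vector that depends only on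
  the distances lies in \<open>\<Lambda>\<close> because every triple has a profile.\<close>

lemma Lambda_iff: "v \<in> Lambda adj \<longleftrightarrow> (\<exists>g. triple_class v g)"
proof
  assume "v \<in> Lambda adj"
  moreover have "Lambda adj \<subseteq> {v. \<exists>g. triple_class v g}" unfolding Lambda_def
  proof (rule vec.span_minimal)
    show "profile_vec adj ` profiles (diam adj) \<subseteq> {v. \<exists>g. triple_class v g}"
    proof (intro image_subsetI CollectI)
      fix p :: "nat \<times> nat \<times> nat \<times> nat"
      obtain r s t u :: nat where p: "p = (r, s, t, u)" by (cases p)
      define g :: grid_fun where "g = (\<lambda>i h j. of_bool (r + s + t + u = diam adj
         \<and> i = int (s + t) \<and> h = int (t + u) \<and> j = int (u + s)))"
      have "triple_class (profile_vec adj p) g"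
        unfolding triple_class_def profile_vec_component p has_profile_def g_def of_nat_eq_iff prod.case
        by simp
      then show "\<exists>g. triple_class (profile_vec adj p) g" by blast
    qed
    show "vec.subspace {v. \<exists>g. triple_class v g}"
    proof (rule vec.subspaceI; clarsimp simp: triple_class_def)
      show "\<exists>g. \<forall>x y z. g (int (dist x y)) (int (dist y z)) (int (dist z x)) = (0::complex)"
        by (intro exI[of _ "\<lambda>_ _ _. 0"]) simp
    next
      fix g g' :: grid_fun
      show "\<exists>f. \<forall>x y z. g (int (dist x y)) (int (dist y z)) (int (dist z x))
          + g' (int (dist x y)) (int (dist y z)) (int (dist z x))
          = f (int (dist x y)) (int (dist y z)) (int (dist z x))"
        by (intro exI[of _ "\<lambda>i h j. g i h j + g' i h j"]) simp
    next
      fix c and g :: grid_fun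
      show "\<exists>f. \<forall>x y z. c * g (int (dist x y)) (int (dist y z)) (int (dist z x))
          = f (int (dist x y)) (int (dist y z)) (int (dist z x))"
        by (intro exI[of _ "\<lambda>i h j. c * g i h j"]) simp
    qed
  qed
  ultimately show "\<exists>g. triple_class v g" by blast
next
  assume "\<exists>g. triple_class v g"
  then obtain g where g: "triple_class v g" by blast
  define c :: "nat \<times> nat \<times> nat \<times> nat \<Rightarrow> complex"
    where "c = (\<lambda>(r, s, t, u). g (int (s + t)) (int (t + u)) (int (u + s)))"
  have "v $ (x, y, z) = (\<Sum>p\<in>profiles D. c p *s profile_vec adj p) $ (x, y, z)" for x y z
  proof -
    obtain p where p: "p \<in> profiles D" "has_profile adj x y z p" using profile_exists by blast
    have iff: "has_profile adj x y z p' \<longleftrightarrow> p' = p" for p'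
      using p(2) has_profile_unique by blast
    have "(\<Sum>p\<in>profiles D. c p *s profile_vec adj p) $ (x, y, z)
        = (\<Sum>p'\<in>profiles D. if p' = p then c p else 0)"
      unfolding sum_component vector_smult_component profile_vec_component
      unfolding iff by (intro sum.cong refl) simp
    also have "\<dots> = c p" using p finite_profiles by simp
    also have "\<dots> = v $ (x, y, z)"
      using p(2) g by (cases p) (simp only: c_def triple_class_def has_profile_def prod.case)
    finally show ?thesis by simp
  qed
  then have "v = (\<Sum>p\<in>profiles D. c p *s profile_vec adj p)" by (auto simp: vec_eq_iff)
  then show "v \<in> Lambda adj" unfolding Lambda_def D_eq
    by (auto intro!: vec.span_sum vec.span_scale intro: vec.span_base)
qed

lemma triple_class_A_1: "triple_class v g \<Longrightarrow> triple_class (A_1 adj v) (\<lambda>i h j. K * x_move (int D) g i h j)"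
  unfolding triple_class_def A_1_component x_move_def
proof (intro allI)
  fix x y z
  assume "\<forall>x y z. v $ (x, y, z) = g (int (dist x y)) (int (dist y z)) (int (dist z x))"
  then have "(\<Sum>w | adj x w. v $ (w, y, z)) = (\<Sum>w | adj x w. g (int (dist w y)) (int (dist y z)) (int (dist w z)))"
    using dist_sym[of z] by simp
  then show "(\<Sum>w | adj x w. v $ (w, y, z)) = K * (\<Sum>\<epsilon>\<in>{1, -1}. \<Sum>\<delta>\<in>{1, -1}.
     move_coeff (int D) \<epsilon> \<delta> (int D - 2 * int (dist x y)) (int D - 2 * int (dist z x)) (int D - 2 * int (dist y z))
      * g (int (dist x y) + \<epsilon>) (int (dist y z)) (int (dist z x) + \<delta>))"
    using dist_sym[of z x]
    by (simp only: sum_neighbours[where f = "\<lambda>a b. g a (int (dist y z)) b"] neighbour_count_eq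
         sum_distrib_left mult.assoc cong: sum.cong)
qed

lemma triple_class_A_2: "triple_class v g \<Longrightarrow> triple_class (A_2 adj v) (\<lambda>i h j. K * y_move (int D) g i h j)"
  unfolding triple_class_def A_2_component y_move_def
proof (intro allI)
  fix x y z
  assume "\<forall>x y z. v $ (x, y, z) = g (int (dist x y)) (int (dist y z)) (int (dist z x))"
  then have "(\<Sum>w | adj y w. v $ (x, w, z)) = (\<Sum>w | adj y w. g (int (dist w x)) (int (dist w z)) (int (dist z x)))"
    using dist_sym[of x] by simp
  then show "(\<Sum>w | adj y w. v $ (x, w, z)) = K * (\<Sum>\<epsilon>\<in>{1, -1}. \<Sum>\<eta>\<in>{1, -1}.
     move_coeff (int D) \<epsilon> \<eta> (int D - 2 * int (dist x y)) (int D - 2 * int (dist y z)) (int D - 2 * int (dist z x))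
      * g (int (dist x y) + \<epsilon>) (int (dist y z) + \<eta>) (int (dist z x)))"
    using dist_sym[of x y] dist_sym[of x z]
    by (simp only: sum_neighbours[where f = "\<lambda>a b. g a b (int (dist z x))"] neighbour_count_eq
         sum_distrib_left mult.assoc cong: sum.cong)
qed

lemma triple_class_A_3: "triple_class v g \<Longrightarrow> triple_class (A_3 adj v) (\<lambda>i h j. K * z_move (int D) g i h j)"
  unfolding triple_class_def A_3_component z_move_def
proof (intro allI)
  fix x y z
  assume "\<forall>x y z. v $ (x, y, z) = g (int (dist x y)) (int (dist y z)) (int (dist z x))"
  then have "(\<Sum>w | adj z w. v $ (x, y, w)) = (\<Sum>w | adj z w. g (int (dist x y)) (int (dist w y)) (int (dist w x)))"
    using dist_sym[of y] by simp
  then show "(\<Sum>w | adj z w. v $ (x, y, w)) = K * (\<Sum>\<eta>\<in>{1, -1}. \<Sum>\<zeta>\<in>{1, -1}.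
     move_coeff (int D) \<eta> \<zeta> (int D - 2 * int (dist y z)) (int D - 2 * int (dist z x)) (int D - 2 * int (dist x y))
      * g (int (dist x y)) (int (dist y z) + \<eta>) (int (dist z x) + \<zeta>))"
    using dist_sym[of y z] dist_sym[of y x]
    by (simp only: sum_neighbours[where f = "\<lambda>a b. g (int (dist x y)) a b"] neighbour_count_eq
         sum_distrib_left mult.assoc cong: sum.cong)
qed

lemma triple_class_Astar:
  assumes "triple_class v g"
  shows "triple_class (Astar_1 adj E v) (\<lambda>i h j. K * yz_mult (int D) g i h j)"
    and "triple_class (Astar_2 adj E v) (\<lambda>i h j. K * zx_mult (int D) g i h j)"
    and "triple_class (Astar_3 adj E v) (\<lambda>i h j. K * xy_mult (int D) g i h j)"
  using assms unfolding triple_class_def Astar_1_component Astar_2_component Astar_3_component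
    theta_def yz_mult_def zx_mult_def xy_mult_def by simp_all

section \<open>The defining relations on the tensor cube\<close>

text \<open>With \<open>\<theta>\<close> and \<open>\<theta>'\<close> proportional to \<open>[I]\<close> and \<open>[I \<plusminus> 2]\<close>, the quadratic form on the left takes the same value
  for all \<open>I\<close>; it is the invariant of the recurrence \<open>[I-2] + [I+2] = {2}[I]\<close>.\<close>

lemma theta_multiplier_relation:
  assumes "adj x w"
  shows "theta (int (dist x y)) * theta (int (dist x y)) - qc 2 * theta (int (dist x y)) * theta (int (dist w y))
     + theta (int (dist w y)) * theta (int (dist w y)) = (K * qs 2)\<^sup>2"
proof -
  define I where "I = int D - 2 * int (dist x y)"
  have x: "theta (int (dist x y)) = K * qs I" by (simp add: theta_def I_def)
  have "qs I * qs I - qc 2 * (qs I * qs (I - 2)) + qs (I - 2) * qs (I - 2) = qs 2 * qs 2"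
    unfolding qs_mult_qs right_diff_distrib qc_mult_qc
    using qc_uminus[of "2 * I - 4"] by (simp add: algebra_simps)
  moreover have "qs I * qs I - qc 2 * (qs I * qs (I + 2)) + qs (I + 2) * qs (I + 2) = qs 2 * qs 2"
    unfolding qs_mult_qs right_diff_distrib qc_mult_qc
    using qc_uminus[of "2 * I"] by (simp add: algebra_simps)
  ultimately have rel: "qs I * qs I - qc 2 * (qs I * qs M) + qs M * qs M = qs 2 * qs 2"
    if "M = I - 2 \<or> M = I + 2" for M using that by blast
  obtain M where M: "M = I - 2 \<or> M = I + 2" "theta (int (dist w y)) = K * qs M"
  proof
    show "int D - 2 * int (dist w y) = I - 2 \<or> int D - 2 * int (dist w y) = I + 2"
      using neighbour_dist[OF assms, of y] by (auto simp: I_def)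
  qed (simp add: theta_def)
  have "K * K * (qs I * qs I - qc 2 * (qs I * qs M) + qs M * qs M) = (K * qs 2)\<^sup>2"
    unfolding rel[OF M(1)] by (simp add: power2_eq_square)
  then show ?thesis unfolding x M(2) by (simp add: algebra_simps)
qed

lemma sum_neighbours_one:
  "(\<Sum>w | adj x w. f (int (dist w y)))
   = K * (qs (2 * int (dist x y)) / qc (int D - 2 * int (dist x y))) * f (int (dist x y) - 1)
   + K * (qs (2 * int D - 2 * int (dist x y)) / qc (int D - 2 * int (dist x y))) * f (int (dist x y) + 1)"
proof -
  let ?C = "{w. adj x w \<and> int (dist w y) = int (dist x y) - 1}"
  let ?F = "{w. adj x w \<and> int (dist w y) = int (dist x y) + 1}"
  have "{w. adj x w} = ?C \<union> ?F" using neighbour_dist[of x _ y] by blast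
  then have "(\<Sum>w | adj x w. f (int (dist w y))) = (\<Sum>w\<in>?C. f (int (dist w y))) + (\<Sum>w\<in>?F. f (int (dist w y)))"
    by (simp only:) (rule sum.union_disjoint, auto)
  also have "\<dots> = of_nat (card ?C) * f (int (dist x y) - 1) + of_nat (card ?F) * f (int (dist x y) + 1)"
    by (intro arg_cong2[of _ _ _ _ "(+)"]) simp_all
  finally show ?thesis unfolding card_neighbours_closer card_neighbours_further .
qed

lemma valency: "of_nat (card {w. adj x w}) = K * qs (int D)"
proof -
  have e: "qs (2 * int D) = qs (int D) * qc (int D)"
    using qs_mult_qc[of "int D" "int D"] by (simp add: qs_zero)
  show ?thesis
    using sum_neighbours_one[where f = "\<lambda>_. 1" and x = x and y = x]
    by (simp add: e dist_self qs_zero qc_nonzero)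
qed

text \<open>The vector of the \<open>\<theta>\<close>s is a column of \<open>E\<^sub>1\<close> up to a factor, and \<open>\<theta>\<^sub>1 = K [D-2]\<close> is its eigenvalue.\<close>

lemma theta_eigenvector:
  "(\<Sum>w | adj x w. theta (int (dist w y))) = K * qs (int D - 2) * theta (int (dist x y))"
proof -
  define I where "I = int D - 2 * int (dist x y)"
  have 2: "2 * int (dist x y) = int D - I" "2 * int D - 2 * int (dist x y) = int D + I" by (simp_all add: I_def)
  have th: "theta (int (dist x y) - 1) = K * qs (I + 2)" "theta (int (dist x y) + 1) = K * qs (I - 2)"
    "theta (int (dist x y)) = K * qs I" by (simp_all add: theta_def I_def algebra_simps)
  have "(\<Sum>w | adj x w. theta (int (dist w y)))
      = K * (qs (int D - I) / qc I) * (K * qs (I + 2)) + K * (qs (int D + I) / qc I) * (K * qs (I - 2))"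
    unfolding th[symmetric] 2[symmetric]
    using sum_neighbours_one[where f = theta and x = x and y = y] by (simp only: I_def)
  also have "\<dots> = K * K / qc I * (qs (int D - I) * qs (I + 2) + qs (int D + I) * qs (I - 2))"
    by (simp add: field_simps qc_nonzero)
  also have "qs (int D - I) * qs (I + 2) + qs (int D + I) * qs (I - 2) = qs (int D - 2) * (qs I * qc I)"
    unfolding qs_mult_qc distrib_left qs_mult_qs using qs_zero
    by (simp add: qs_mult_qs algebra_simps)
  finally show ?thesis unfolding th using qc_nonzero[of I] by simp
qed

text \<open>The sum runs over the walks \<open>x, w, x'\<close>. For \<open>x' \<noteq> x\<close> the terms with a given \<open>x'\<close> cancel by
  \<open>balanced_neighbours\<close>, in which the two coefficients agree at distance 2. For \<open>x' = x\<close> they are evaluated by means of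
  the valency and the eigenvalue.\<close>

lemma theta_neighbour_relation:
  "(\<Sum>w | adj x w. \<Sum>x' | adj w x'. (theta (int (dist x' y)) - qc 2 * theta (int (dist w y)) + theta (int (dist x y))) * v x')
     = (K * qs 2)\<^sup>2 * theta (int (dist x y)) * v x"
proof -
  define t where "t = (\<lambda>x. theta (int (dist x y)))"
  \<comment> \<open>the total weight of the walks of length 2 from \<open>x\<close> to \<open>x'\<close>\<close>
  define C where "C = (\<lambda>x'. \<Sum>w | adj x w \<and> adj w x'. t x' - qc 2 * t w + t x)"
  have "(\<Sum>w | adj x w. \<Sum>x' | adj w x'. (t x' - qc 2 * t w + t x) * v x')
      = (\<Sum>w | adj x w. \<Sum>x'\<in>UNIV. (t x' - qc 2 * t w + t x) * v x' * of_bool (adj w x'))" by simp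
  also have "\<dots> = (\<Sum>x'\<in>UNIV. \<Sum>w | adj x w. (t x' - qc 2 * t w + t x) * v x' * of_bool (adj w x'))"
    by (rule sum.swap)
  also have "\<dots> = (\<Sum>x'\<in>UNIV. C x' * v x')"
    by (simp add: C_def Collect_conj_eq sum_distrib_right)
  also have "\<dots> = (\<Sum>x'\<in>UNIV. if x' = x then (K * qs 2)\<^sup>2 * t x * v x else 0)"
  proof (intro sum.cong refl)
    fix x'
    show "C x' * v x' = (if x' = x then (K * qs 2)\<^sup>2 * t x * v x else 0)"
    proof (cases "x' = x")
      case True
      have "{w. adj x w \<and> adj w x} = {w. adj x w}" using adj_sym by blast
      then have "C x = (\<Sum>w | adj x w. 2 * t x - qc 2 * t w)" by (simp add: C_def algebra_simps)
      also have "\<dots> = 2 * (K * qs (int D)) * t x - qc 2 * (K * qs (int D - 2) * t x)"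
        by (simp add: sum_subtractf sum_distrib_left[symmetric] valency t_def theta_eigenvector)
      also have "\<dots> = K * (2 * qs (int D) - qs (int D - 2) * qc 2) * t x" by (simp add: algebra_simps)
      also have "2 * qs (int D) - qs (int D - 2) * qc 2 = qs 2 * (K * qs 2)"
        unfolding qs_mult_qc using qs_mult_qc[of 2 "int D - 2"] qs_uminus[of "int D - 4"] qs_eq_0_iff[of 2]
        by (simp add: K_def algebra_simps)
      finally show ?thesis using True by (simp add: power2_eq_square)
    next
      case False
      show ?thesis
      proof (cases "{w. adj x w \<and> adj w x'} = {}")
        case True
        then have "C x' = 0" unfolding C_def by (simp only: sum.empty)
        then show ?thesis using False by simp
      next
        case nonempty: False
        then obtain w where w: "adj x w" "adj w x'" by blast
        have d: "int (dist x x') = 2"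
        proof -
          have "dist w x' = 1" using w(2) dist_eq_1_iff by simp
          then have "int (dist x x') = 1 + 1 \<or> int (dist x x') = 1 - 1"
            using neighbour_dist[OF w(1), of x'] by auto
          then show ?thesis using False dist_eq_0_iff[of x x'] by auto
        qed
        have S: "{w. adj x w \<and> adj w x'} = {w. adj x w \<and> int (dist w x') = 2 - 1}"
          using dist_eq_1_iff by auto
        have card: "of_nat (card {w. adj x w \<and> adj w x'}) = K * qs 4 / qc (int D - 4)"
          using card_neighbours_closer[of x x'] unfolding S d by simp
        have sum_t: "(\<Sum>w | adj x w \<and> adj w x'. t w) = K * qs 2 / qc (int D - 4) * (t x + t x')"
          using balanced_neighbours[where x = x and z = x' and y = y] unfolding S d t_def
          by (simp add: algebra_simps add_divide_distrib)
        have "C x' = of_nat (card {w. adj x w \<and> adj w x'}) * (t x' + t x) - qc 2 * (\<Sum>w | adj x w \<and> adj w x'. t w)"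
          by (simp add: C_def sum.distrib sum_subtractf sum_distrib_left distrib_left)
        also have "\<dots> = K / qc (int D - 4) * (qs 4 - qs 2 * qc 2) * (t x' + t x)"
          unfolding card sum_t by (simp add: field_simps qc_nonzero)
        also have "\<dots> = 0" by (simp add: qs_mult_qc qs_zero)
        finally show ?thesis using False by simp
      qed
    qed
  qed
  finally show ?thesis by (simp add: t_def)
qed

lemma multiplier_neighbour_relation:
  assumes t: "\<And>w. t w = theta (int (dist w y))" and ab: "a\<^sup>2 * (K * qs 2)\<^sup>2 = - 1"
  shows "a * (t x * (a * (t x * (b * (\<Sum>w | adj x w. u w)))))
     - qc 2 * (a * (t x * (b * (\<Sum>w | adj x w. a * (t w * u w)))))
     + b * (\<Sum>w | adj x w. a * (t w * (a * (t w * u w)))) = - (b * (\<Sum>w | adj x w. u w))"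
proof -
  have "a * (t x * (a * (t x * (b * (\<Sum>w | adj x w. u w)))))
     - qc 2 * (a * (t x * (b * (\<Sum>w | adj x w. a * (t w * u w)))))
     + b * (\<Sum>w | adj x w. a * (t w * (a * (t w * u w))))
     = b * (\<Sum>w | adj x w. a\<^sup>2 * (t x * t x - qc 2 * t x * t w + t w * t w) * u w)"
    by (simp add: sum_distrib_left sum.distrib sum_subtractf algebra_simps power2_eq_square)
  also have "\<dots> = b * (\<Sum>w | adj x w. - u w)"
    using ab theta_multiplier_relation[of x _ y] by (simp add: t)
  finally show ?thesis by (simp add: sum_negf)
qed

lemma neighbour_multiplier_relation:
  assumes t: "\<And>w. t w = theta (int (dist w y))" and ab: "b\<^sup>2 * (K * qs 2)\<^sup>2 = - 1"
  shows "b * (\<Sum>w | adj x w. b * (\<Sum>x' | adj w x'. a * (t x' * u x')))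
     - qc 2 * (b * (\<Sum>w | adj x w. a * (t w * (b * (\<Sum>x' | adj w x'. u x')))))
     + a * (t x * (b * (\<Sum>w | adj x w. b * (\<Sum>x' | adj w x'. u x')))) = - (a * (t x * u x))"
proof -
  have "b * (\<Sum>w | adj x w. b * (\<Sum>x' | adj w x'. a * (t x' * u x')))
     - qc 2 * (b * (\<Sum>w | adj x w. a * (t w * (b * (\<Sum>x' | adj w x'. u x')))))
     + a * (t x * (b * (\<Sum>w | adj x w. b * (\<Sum>x' | adj w x'. u x'))))
     = a * b\<^sup>2 * (\<Sum>w | adj x w. \<Sum>x' | adj w x'. (t x' - qc 2 * t w + t x) * u x')"
    by (simp add: sum_distrib_left sum.distrib sum_subtractf algebra_simps power2_eq_square)
  also have "\<dots> = a * (b\<^sup>2 * (K * qs 2)\<^sup>2) * t x * u x"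
    unfolding t theta_neighbour_relation by (simp add: ac_simps)
  finally show ?thesis unfolding ab by simp
qed

definition so6_gen :: "nat \<Rightarrow> complex^('a \<times> 'a \<times> 'a) \<Rightarrow> complex^('a \<times> 'a \<times> 'a)" where
  "so6_gen i v =
    (if i = 1 then (1 / (H * qs 2)) *s Astar_1 adj E v
     else if i = 2 then (1 / (H * qs (- 2))) *s A_3 adj v
     else if i = 3 then (1 / (H * qs 2)) *s Astar_2 adj E v
     else if i = 4 then (1 / (H * qs (- 2))) *s A_1 adj v
     else (1 / (H * qs 2)) *s Astar_3 adj E v)"

lemma so6_gen_component:
  "so6_gen 1 v $ (x, y, z) = 1 / (H * qs 2) * (theta (int (dist y z)) * v $ (x, y, z))"
  "so6_gen 2 v $ (x, y, z) = 1 / (H * qs (- 2)) * (\<Sum>w | adj z w. v $ (x, y, w))"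
  "so6_gen 3 v $ (x, y, z) = 1 / (H * qs 2) * (theta (int (dist z x)) * v $ (x, y, z))"
  "so6_gen 4 v $ (x, y, z) = 1 / (H * qs (- 2)) * (\<Sum>w | adj x w. v $ (w, y, z))"
  "so6_gen 5 v $ (x, y, z) = 1 / (H * qs 2) * (theta (int (dist x y)) * v $ (x, y, z))"
  by (simp_all add: so6_gen_def Astar_1_component Astar_2_component Astar_3_component
      A_1_component A_3_component)

text \<open>Both types of generators are normalised by the same square, as \<open>K = H \<i>\<close>; the sign is that of \<open>\<i>\<^sup>2\<close>.\<close>

lemma normalisation: "(1 / (H * qs 2))\<^sup>2 * (K * qs 2)\<^sup>2 = - 1"
  "(1 / (H * qs (- 2)))\<^sup>2 * (K * qs 2)\<^sup>2 = - 1"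
proof -
  have "H \<noteq> 0" using H_i K_nonzero by auto
  then show "(1 / (H * qs 2))\<^sup>2 * (K * qs 2)\<^sup>2 = - 1" "(1 / (H * qs (- 2)))\<^sup>2 * (K * qs 2)\<^sup>2 = - 1"
    using qs_eq_0_iff[of 2] by (simp_all add: qs_uminus power_mult_distrib power_divide flip: H_i)
qed

lemma so6_gen_cubic:
  assumes "i \<in> {1..5}" "j \<in> {1..5}" "\<bar>int i - int j\<bar> = 1"
  shows "so6_gen i (so6_gen i (so6_gen j v)) - qc 2 *s so6_gen i (so6_gen j (so6_gen i v))
    + so6_gen j (so6_gen i (so6_gen i v)) = - so6_gen j v"
proof -
  have "i = 1 \<and> j = 2 \<or> i = 2 \<and> j = 1 \<or> i = 3 \<and> j = 2 \<or> i = 2 \<and> j = 3 \<or>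
    i = 3 \<and> j = 4 \<or> i = 4 \<and> j = 3 \<or> i = 5 \<and> j = 4 \<or> i = 4 \<and> j = 5"
    using assms unfolding atLeastAtMost_iff by presburger
  then consider "i = 1" "j = 2" | "i = 2" "j = 1" | "i = 3" "j = 2" | "i = 2" "j = 3"
    | "i = 3" "j = 4" | "i = 4" "j = 3" | "i = 5" "j = 4" | "i = 4" "j = 5"
    by blast
  then have "so6_gen i (so6_gen i (so6_gen j v)) $ (x, y, z) - qc 2 * so6_gen i (so6_gen j (so6_gen i v)) $ (x, y, z)
    + so6_gen j (so6_gen i (so6_gen i v)) $ (x, y, z) = - (so6_gen j v $ (x, y, z))" for x y z
  proof cases
    case 1
    then show ?thesis unfolding so6_gen_component
      by (simp only:, unfold so6_gen_component)
        (rule multiplier_neighbour_relation[where t = "\<lambda>w. theta (int (dist y w))" and y = y and x = z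
            and a = "1 / (H * qs 2)" and b = "1 / (H * qs (- 2))" and u = "\<lambda>w. v $ (x, y, w)",
          OF _ normalisation(1)], simp only: dist_sym)
  next
    case 2
    then show ?thesis unfolding so6_gen_component
      by (simp only:, unfold so6_gen_component)
        (rule neighbour_multiplier_relation[where t = "\<lambda>w. theta (int (dist y w))" and y = y and x = z
            and a = "1 / (H * qs 2)" and b = "1 / (H * qs (- 2))" and u = "\<lambda>w. v $ (x, y, w)",
          OF _ normalisation(2)], simp only: dist_sym)
  next
    case 3
    then show ?thesis unfolding so6_gen_component
      by (simp only:, unfold so6_gen_component)
        (rule multiplier_neighbour_relation[where t = "\<lambda>w. theta (int (dist w x))" and y = x and x = z
            and a = "1 / (H * qs 2)" and b = "1 / (H * qs (- 2))" and u = "\<lambda>w. v $ (x, y, w)",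
          OF _ normalisation(1)], simp only: dist_sym)
  next
    case 4
    then show ?thesis unfolding so6_gen_component
      by (simp only:, unfold so6_gen_component)
        (rule neighbour_multiplier_relation[where t = "\<lambda>w. theta (int (dist w x))" and y = x and x = z
            and a = "1 / (H * qs 2)" and b = "1 / (H * qs (- 2))" and u = "\<lambda>w. v $ (x, y, w)",
          OF _ normalisation(2)], simp only: dist_sym)
  next
    case 5
    then show ?thesis unfolding so6_gen_component
      by (simp only:, unfold so6_gen_component)
        (rule multiplier_neighbour_relation[where t = "\<lambda>w. theta (int (dist z w))" and y = z and x = x
            and a = "1 / (H * qs 2)" and b = "1 / (H * qs (- 2))" and u = "\<lambda>w. v $ (w, y, z)",
          OF _ normalisation(1)], simp only: dist_sym)
  next
    case 6
    then show ?thesis unfolding so6_gen_component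
      by (simp only:, unfold so6_gen_component)
        (rule neighbour_multiplier_relation[where t = "\<lambda>w. theta (int (dist z w))" and y = z and x = x
            and a = "1 / (H * qs 2)" and b = "1 / (H * qs (- 2))" and u = "\<lambda>w. v $ (w, y, z)",
          OF _ normalisation(2)], simp only: dist_sym)
  next
    case 7
    then show ?thesis unfolding so6_gen_component
      by (simp only:, unfold so6_gen_component)
        (rule multiplier_neighbour_relation[where t = "\<lambda>w. theta (int (dist w y))" and y = y and x = x
            and a = "1 / (H * qs 2)" and b = "1 / (H * qs (- 2))" and u = "\<lambda>w. v $ (w, y, z)",
          OF _ normalisation(1)], simp only: dist_sym)
  next
    case 8
    then show ?thesis unfolding so6_gen_component
      by (simp only:, unfold so6_gen_component)
        (rule neighbour_multiplier_relation[where t = "\<lambda>w. theta (int (dist w y))" and y = y and x = x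
            and a = "1 / (H * qs 2)" and b = "1 / (H * qs (- 2))" and u = "\<lambda>w. v $ (w, y, z)",
          OF _ normalisation(2)], simp only: dist_sym)
  qed
  then show ?thesis by (auto simp: vec_eq_iff)
qed

lemma so6_gen_commute:
  assumes "i \<in> {1..5}" "j \<in> {1..5}" "\<bar>int i - int j\<bar> \<ge> 2"
  shows "so6_gen i (so6_gen j v) = so6_gen j (so6_gen i v)"
proof -
  have comm: "so6_gen i (so6_gen j v) $ (x, y, z) = so6_gen j (so6_gen i v) $ (x, y, z)"
    if "(i, j) \<in> {(1, 3), (1, 4), (1, 5), (2, 4), (2, 5), (3, 5)}" for i j x y z
  proof (cases "(i, j) = (2, 4)")
    case True
    then show ?thesis unfolding prod.inject
      by (elim conjE; hypsubst) (unfold so6_gen_component sum_distrib_left, subst sum.swap, simp only: mult.left_commute)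
  next
    case False
    with that have "(i, j) \<in> {(1, 3), (1, 4), (1, 5), (2, 5), (3, 5)}" by blast
    then show ?thesis unfolding insert_iff empty_iff prod.inject
      by (elim disjE conjE FalseE; hypsubst; unfold so6_gen_component sum_distrib_left; simp only: mult.left_commute)
  qed
  have "(i, j) \<in> {(1, 3), (1, 4), (1, 5), (2, 4), (2, 5), (3, 5)} \<or> (j, i) \<in> {(1, 3), (1, 4), (1, 5), (2, 4), (2, 5), (3, 5)}"
    using assms unfolding atLeastAtMost_iff insert_iff empty_iff prod.inject by presburger
  then have "so6_gen i (so6_gen j v) $ (x, y, z) = so6_gen j (so6_gen i v) $ (x, y, z)" for x y z
    using comm[of i j x y z] comm[of j i x y z] by (elim disjE) simp_all
  then show ?thesis by (auto simp: vec_eq_iff)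
qed

lemma so6_gen_linear: "so6_gen i (v + w) = so6_gen i v + so6_gen i w" "so6_gen i (c *s v) = c *s so6_gen i v"
proof -
  have "so6_gen i (v + w) $ (x, y, z) = (so6_gen i v + so6_gen i w) $ (x, y, z)"
    "so6_gen i (c *s v) $ (x, y, z) = (c *s so6_gen i v) $ (x, y, z)" for x y z
    by (simp_all add: so6_gen_def Astar_1_component Astar_2_component Astar_3_component
        A_1_component A_3_component sum.distrib algebra_simps sum_distrib_left)
  then show "so6_gen i (v + w) = so6_gen i v + so6_gen i w" "so6_gen i (c *s v) = c *s so6_gen i v"
    by (auto simp: vec_eq_iff)
qed

section \<open>The action of \<open>B\<^sub>6\<close> on \<open>\<Lambda>\<close>\<close>

lemma triple_class_scale: "triple_class v g \<Longrightarrow> triple_class (c *s v) (\<lambda>i h j. c * g i h j)"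
  by (simp add: triple_class_def)

lemma triple_class_unique: "triple_class v g \<Longrightarrow> triple_class w g \<Longrightarrow> v = w"
  by (auto simp: triple_class_def vec_eq_iff)

text \<open>The normalisations of the generators become \<open>K / (H [2]) = \<i> / [2]\<close> and its negative.\<close>

lemma triple_class_so6_gen:
  assumes "triple_class v g"
  defines "a \<equiv> \<i> / qs 2"
  shows "triple_class (so6_gen 1 v) (\<lambda>i h j. a * yz_mult (int D) g i h j)"
    "triple_class (so6_gen 2 v) (\<lambda>i h j. - a * z_move (int D) g i h j)"
    "triple_class (so6_gen 3 v) (\<lambda>i h j. a * zx_mult (int D) g i h j)"
    "triple_class (so6_gen 4 v) (\<lambda>i h j. - a * x_move (int D) g i h j)"
    "triple_class (so6_gen 5 v) (\<lambda>i h j. a * xy_mult (int D) g i h j)"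
    "triple_class ((1 / (H * qs (- 2))) *s A_2 adj v) (\<lambda>i h j. - a * y_move (int D) g i h j)"
proof -
  have "H \<noteq> 0" using H_i K_nonzero by auto
  then have a: "1 / (H * qs 2) * K = a" "1 / (H * qs (- 2)) * K = - a"
    by (simp_all add: a_def qs_uminus flip: H_i)
  show "triple_class (so6_gen 1 v) (\<lambda>i h j. a * yz_mult (int D) g i h j)"
    "triple_class (so6_gen 2 v) (\<lambda>i h j. - a * z_move (int D) g i h j)"
    "triple_class (so6_gen 3 v) (\<lambda>i h j. a * zx_mult (int D) g i h j)"
    "triple_class (so6_gen 4 v) (\<lambda>i h j. - a * x_move (int D) g i h j)"
    "triple_class (so6_gen 5 v) (\<lambda>i h j. a * xy_mult (int D) g i h j)"
    "triple_class ((1 / (H * qs (- 2))) *s A_2 adj v) (\<lambda>i h j. - a * y_move (int D) g i h j)"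
    using triple_class_scale[OF triple_class_Astar(1)[OF assms(1)], of "1 / (H * qs 2)"]
      triple_class_scale[OF triple_class_Astar(2)[OF assms(1)], of "1 / (H * qs 2)"]
      triple_class_scale[OF triple_class_Astar(3)[OF assms(1)], of "1 / (H * qs 2)"]
      triple_class_scale[OF triple_class_A_1[OF assms(1)], of "1 / (H * qs (- 2))"]
      triple_class_scale[OF triple_class_A_2[OF assms(1)], of "1 / (H * qs (- 2))"]
      triple_class_scale[OF triple_class_A_3[OF assms(1)], of "1 / (H * qs (- 2))"]
    unfolding mult.assoc[symmetric] a so6_gen_def by simp_all
qed

lemma so6_gen_closed:
  assumes "i \<in> {1..5}" "v \<in> Lambda adj"
  shows "so6_gen i v \<in> Lambda adj"
proof -
  obtain g where g: "triple_class v g" using assms(2) Lambda_iff by blast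
  have "i \<in> {1, 2, 3, 4, 5}" using assms(1) by auto
  then show ?thesis using triple_class_so6_gen[OF g] unfolding Lambda_iff by blast
qed

definition grid_homogeneous :: "(grid_fun \<Rightarrow> grid_fun) \<Rightarrow> bool" where
  "grid_homogeneous \<Phi> \<longleftrightarrow> (\<forall>c g. \<Phi> (\<lambda>i h j. c * g i h j) = (\<lambda>i h j. c * \<Phi> g i h j))"

lemma grid_homogeneous_basic:
  "grid_homogeneous (x_move d)" "grid_homogeneous (y_move d)" "grid_homogeneous (z_move d)"
  "grid_homogeneous (xy_mult d)" "grid_homogeneous (yz_mult d)" "grid_homogeneous (zx_mult d)"
  by (simp_all add: grid_homogeneous_def x_move_def y_move_def z_move_def xy_mult_def yz_mult_def
      zx_mult_def fun_eq_iff algebra_simps)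

text \<open>The scalar is kept apart so that the grid operators remain free of normalisations; homogeneity allows
  scalars to be pulled out of nested commutators.\<close>

definition represents :: "complex \<Rightarrow> (complex^('a \<times> 'a \<times> 'a) \<Rightarrow> complex^('a \<times> 'a \<times> 'a)) \<Rightarrow>
    (grid_fun \<Rightarrow> grid_fun) \<Rightarrow> bool" where
  "represents c F \<Phi> \<longleftrightarrow> grid_homogeneous \<Phi> \<and>
     (\<forall>v g. triple_class v g \<longrightarrow> triple_class (F v) (\<lambda>i h j. c * \<Phi> g i h j))"

lemma represents_qcomm:
  assumes F: "represents c F \<Phi>" and G: "represents e G \<Psi>"
  shows "represents (c * e) (op_qcomm q F G) (grid_qcomm \<Phi> \<Psi>)"
proof -
  have hom: "\<Phi> (\<lambda>i h j. b * g i h j) = (\<lambda>i h j. b * \<Phi> g i h j)"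
    "\<Psi> (\<lambda>i h j. b * g i h j) = (\<lambda>i h j. b * \<Psi> g i h j)" for b g
    using F G by (simp_all add: represents_def grid_homogeneous_def)
  have "grid_homogeneous (grid_qcomm \<Phi> \<Psi>)"
    by (simp add: grid_homogeneous_def grid_qcomm_def hom fun_eq_iff algebra_simps)
  moreover have "triple_class (op_qcomm q F G v) (\<lambda>i h j. c * e * grid_qcomm \<Phi> \<Psi> g i h j)"
    if v: "triple_class v g" for v g
  proof -
    have step: "triple_class (F v) (\<lambda>i h j. c * \<Phi> g i h j)" "triple_class (G v) (\<lambda>i h j. e * \<Psi> g i h j)"
      if "triple_class v g" for v g
      using F G that unfolding represents_def by blast+
    have "triple_class (F (G v)) (\<lambda>i h j. c * (e * \<Phi> (\<Psi> g) i h j))"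
      "triple_class (G (F v)) (\<lambda>i h j. e * (c * \<Psi> (\<Phi> g) i h j))"
      using step(1)[OF step(2)[OF v]] step(2)[OF step(1)[OF v]] unfolding hom .
    then show ?thesis
      using q_nonzero by (simp add: triple_class_def op_qcomm_def grid_qcomm_def field_simps)
  qed
  ultimately show ?thesis by (simp add: represents_def)
qed

lemma represents_so6_gen:
  "represents (\<i> / qs 2) (so6_gen 1) (yz_mult (int D))"
  "represents (- (\<i> / qs 2)) (so6_gen 2) (z_move (int D))"
  "represents (\<i> / qs 2) (so6_gen 3) (zx_mult (int D))"
  "represents (- (\<i> / qs 2)) (so6_gen 4) (x_move (int D))"
  "represents (\<i> / qs 2) (so6_gen 5) (xy_mult (int D))"
  unfolding represents_def using triple_class_so6_gen grid_homogeneous_basic by auto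

text \<open>With \<open>a = \<i>/[2]\<close> the five generators contribute the factor \<open>a\<^sup>5\<close>, and \<open>quadruple_bracket\<close> the factor \<open>[2]^4\<close>;
  their product is \<open>a\<close>, and \<open>-a\<close> is the normalisation of the move of \<open>y\<close>.\<close>

lemma B6_acts_as_A_2:
  assumes "v \<in> Lambda adj"
  shows "- op_qcomm q (so6_gen 1) (op_qcomm q (so6_gen 2) (op_qcomm q (so6_gen 3)
      (op_qcomm q (so6_gen 4) (so6_gen 5)))) v = (1 / (H * qs (- 2))) *s A_2 adj v"
proof -
  obtain g where g: "triple_class v g" using assms Lambda_iff by blast
  define a where "a = \<i> / qs 2"
  let ?u = "op_qcomm q (so6_gen 1) (op_qcomm q (so6_gen 2) (op_qcomm q (so6_gen 3)
      (op_qcomm q (so6_gen 4) (so6_gen 5)))) v"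
  have "represents (a * (- a * (a * (- a * a)))) (op_qcomm q (so6_gen 1) (op_qcomm q (so6_gen 2)
      (op_qcomm q (so6_gen 3) (op_qcomm q (so6_gen 4) (so6_gen 5)))))
     (grid_qcomm (yz_mult (int D)) (grid_qcomm (z_move (int D)) (grid_qcomm (zx_mult (int D))
        (grid_qcomm (x_move (int D)) (xy_mult (int D))))))"
    unfolding a_def by (intro represents_qcomm represents_so6_gen)
  then have "triple_class ?u (\<lambda>i h j. a * (- a * (a * (- a * a))) * (qs 2 ^ 4 * y_move (int D) g i h j))"
    using g unfolding represents_def quadruple_bracket by blast
  moreover have "a * (- a * (a * (- a * a))) * (qs 2 ^ 4 * c) = a * c" for c
  proof -
    have "a * (- a * (a * (- a * a))) = (a * qs 2) ^ 4 * a / qs 2 ^ 4"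
      using qs_eq_0_iff[of 2] by (simp add: power4_eq_xxxx)
    also have "a * qs 2 = \<i>" using qs_eq_0_iff[of 2] by (simp add: a_def)
    finally show ?thesis using qs_eq_0_iff[of 2] by (simp add: power4_eq_xxxx)
  qed
  ultimately have "triple_class ?u (\<lambda>i h j. a * y_move (int D) g i h j)" by (simp only:)
  from triple_class_scale[OF this, of "-1"] triple_class_so6_gen(6)[OF g]
  show ?thesis unfolding a_def[symmetric]
    by (intro triple_class_unique[of _ "\<lambda>i h j. - a * y_move (int D) g i h j"])
      (simp_all add: triple_class_def)
qed

sublocale so6_representation so6_gen q "Lambda adj"
proof unfold_locales
  show "vec.subspace (Lambda adj)" unfolding Lambda_def by (rule vec.subspace_span)
qed (use so6_gen_cubic so6_gen_linear so6_gen_closed so6_gen_commute in \<open>simp_all add: qc_def\<close>)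

end

theorem theorem10p19:
  fixes adj :: "'a::finite \<Rightarrow> 'a \<Rightarrow> bool"
    and E :: "nat \<Rightarrow> complex^'a^'a"
    and D :: nat
    and q H :: complex
  assumes "simple_graph adj"
    and "graph_connected adj"
    and "CARD('a) \<ge> 2"
    and "D = diam adj"
    and "D \<ge> 3"
    and "distance_regular adj"
    and "two_homogeneous_bipartite adj"
    and "\<not> is_hypercube adj"
    and "\<not> is_cycle adj"
    and "Q_polynomial_ordering adj E"
    and "q \<noteq> 0"
    and "\<forall>n::nat. n > 0 \<longrightarrow> q ^ n \<noteq> 1"
    and "H = \<i> * ((q powi (int D - 2) + q powi (2 - int D)) / (q powi (-2) - q powi 2))"
    and "\<forall>i\<le>D. eigval adj E i = H * \<i> * (q powi (int D - 2 * int i) - q powi (2 * int i - int D))"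
    and "\<forall>i\<le>D. dual_eigval adj E i = H * \<i> * (q powi (int D - 2 * int i) - q powi (2 * int i - int D))"
    and "\<forall>i\<le>D. of_nat (c_num adj i) = H * \<i> *
           ((q powi (2 * int i) - q powi (- 2 * int i)) /
            (q powi (int D - 2 * int i) + q powi (2 * int i - int D)))"
    and "\<forall>i\<le>D. of_nat (b_num adj i) = H * \<i> *
           ((q powi (2 * int D - 2 * int i) - q powi (2 * int i - 2 * int D)) /
            (q powi (int D - 2 * int i) + q powi (2 * int i - int D)))"
  shows "\<exists>act. complex_algebra_module (U_so6 q) (U_scalar q) (Lambda adj) act \<and>
    (\<forall>v\<in>Lambda adj.
       act (U_gen q 1) v = (1 / (H * (q powi 2 - q powi (-2)))) *s Astar_1 adj E v \<and>
       act (U_gen q 3) v = (1 / (H * (q powi 2 - q powi (-2)))) *s Astar_2 adj E v \<and>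
       act (U_gen q 5) v = (1 / (H * (q powi 2 - q powi (-2)))) *s Astar_3 adj E v \<and>
       act (U_gen q 2) v = (1 / (H * (q powi (-2) - q powi 2))) *s A_3 adj v \<and>
       act (U_gen q 4) v = (1 / (H * (q powi (-2) - q powi 2))) *s A_1 adj v \<and>
       act (U_B6 q) v = (1 / (H * (q powi (-2) - q powi 2))) *s A_2 adj v)"
proof -
  interpret generic_q q using assms(11,12) by unfold_locales auto
  interpret two_homogeneous_graph adj q E D H
  proof unfold_locales
    show "simple_graph adj" "graph_connected adj" "distance_regular adj" "D = diam adj" "3 \<le> D"
      "two_homogeneous_bipartite adj" by fact+
    show "primitive_idempotents adj E"
      using \<open>Q_polynomial_ordering adj E\<close> by (simp add: Q_polynomial_ordering_def)
    show "H = \<i> * (qc (int D - 2) / qs (- 2))" using assms(13) by (simp add: qc_def qs_def)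
    fix i assume i: "i \<le> D"
    show "dual_eigval adj E i = H * \<i> * qs (int D - 2 * int i)"
      using assms(15) i by (simp add: qs_def)
    show "of_nat (c_num adj i) = H * \<i> * (qs (2 * int i) / qc (int D - 2 * int i))"
      using assms(16) i by (simp add: qs_def qc_def)
    show "of_nat (b_num adj i) = H * \<i> * (qs (2 * int D - 2 * int i) / qc (int D - 2 * int i))"
      using assms(17) i by (simp add: qs_def qc_def)
  qed
  have qs2: "q powi 2 - q powi (-2) = qs 2" "q powi (-2) - q powi 2 = qs (- 2)" by (simp_all add: qs_def)
  show ?thesis unfolding qs2
  proof (intro exI[of _ quotient_action] conjI ballI)
    show "complex_algebra_module (U_so6 q) (U_scalar q) (Lambda adj) quotient_action"
      by (rule quotient_module)
  next
    fix v assume v: "v \<in> Lambda adj"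
    show "quotient_action (U_gen q 1) v = (1 / (H * qs 2)) *s Astar_1 adj E v"
      "quotient_action (U_gen q 3) v = (1 / (H * qs 2)) *s Astar_2 adj E v"
      "quotient_action (U_gen q 5) v = (1 / (H * qs 2)) *s Astar_3 adj E v"
      "quotient_action (U_gen q 2) v = (1 / (H * qs (- 2))) *s A_3 adj v"
      "quotient_action (U_gen q 4) v = (1 / (H * qs (- 2))) *s A_1 adj v"
      using quotient_action_gen[OF _ v] by (simp_all add: so6_gen_def)
    show "quotient_action (U_B6 q) v = (1 / (H * qs (- 2))) *s A_2 adj v"
      unfolding quotient_action_B6[OF v] by (rule B6_acts_as_A_2[OF v])
  qed
qed

end
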